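(* Let $\alpha\in[0,1]$, let $4\le n\le 10$, and let $\mathsf{s}_{\mathrm{opt}}=(s_1,\dots,s_n)$ with $s_i=\frac{2i-1}{2n}$ for $i\in\{1,\dots,n\}$. Then in the game with $n$ facilities and parameter $\alpha$, the locations $\mathsf{s}_{\mathrm{opt}}$ (together with the induced client equilibria) yield a $\rho_n$-SPE, where $$\rho_4=\frac12+\frac{2(\alpha^2-2)}{(\alpha-1)\alpha(4+\alpha)-4},$$ $$\rho_5=\frac{12+\alpha(4+\alpha(\alpha(\alpha-2)-10))}{8+\alpha(2+\alpha)(4+(\alpha-6)\alpha)},$$ $$\rho_6=\frac12+\frac{16-16\alpha^2+3\alpha^4}{16+\alpha(16+\alpha(\alpha(\alpha(5+\alpha)-12)-20))},$$ $$\rho_7=\frac{\alpha(\alpha(64+\alpha(16+\alpha(\alpha(\alpha-3)-21)))-16)-48}{\alpha(\alpha(48+\alpha(32+\alpha((\alpha-6)\alpha-18)))-32)-32},$$ $$\rho_8=\frac12+\frac{4(\alpha^2-2)(8-8\alpha^2+\alpha^4)}{\alpha((\alpha-2)\alpha(2+\alpha)(\alpha(\alpha(7+\alpha)-20)-28)-64)-64},$$ $$\rho_9=\frac{192+\alpha(64+\alpha(\alpha(4+\alpha)(\alpha(56+\alpha((\alpha-8)\alpha-4))-24)-352))}{128+(\alpha-2)\alpha(\alpha(2+\alpha)(48+\alpha(48+\alpha((\alpha-8)\alpha-28)))-64)},$$ $$\rho_{10}=\frac12+\frac{256-512\alpha^2+336\alpha^4-80\alpha^6+5\alpha^8}{2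56+\alpha(256+\alpha(\alpha(\alpha(432+\alpha(240+\alpha(\alpha(9\alpha+\alpha^2-40)-120)))-448)-576))}.$$
   Context: The game with parameters $n\ge 1$ and $\alpha\in[0,1]$: there are $n$ facility players $\{1,\dots,n\}$, each choosing a location $s_i\in[0,1]$; a facility location vector is $\mathsf{s}=(s_1,\dots,s_n)\in[0,1]^n$, and $(\mathsf{s}_{-i},s_i')$ is $\mathsf{s}$ with $s_i$ replaced by $s_i'$. The clients are the points $z\in[0,1]$. A client mapping is a function $\mathsf{f}:[0,1]^n\times[0,1]\to\{1,\dots,n\}$; client $z$ uses facility $\mathsf{f}(\mathsf{s},z)$. Only measurable mappings are considered: for every $\mathsf{s}$ and $i$, the set $\{z:\mathsf{f}(\mathsf{s},z)=i\}$ is a finite union of disjoint intervals; its total length is the load $\ell_i(\mathsf{s},\mathsf{f})$. The cost of client $z$ is $C_z(\mathsf{s},\mathsf{f})=(1-\alpha)|s_{\mathsf{f}(\mathsf{s},z)}-z|+\alpha\,\ell_{\mathsf{f}(\mathsf{s},z)}(\mathsf{s},\mathsf{f})$. The utility of facility $i$ is $u_i(\mathsf{s},\mathsf{f})=\ell_i(\mathsf{s},\mathsf{f})$. $\mathsf{f}(\mathsf{t},\cdot)$ is a client equilibrium if for all $z\in[0,1]$ and all $j$, $(1-\alpha)|t_{\mathsf{f}(\mathsf{t},z)}-z|+\alpha\ell_{\mathsf{f}(\mathsf{t},z)}(\mathsf{t},\mathsf{f})\le(1-\alpha)|t_j-z|+\alpha\ell_j(\mathsf{t},\mathsf{f})$.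 A pair $(\mathsf{s},\mathsf{f})$ is a $\rho$-SPE if (1) for all $i$ and all $s_i'\in[0,1]$, $\rho\cdot u_i(\mathsf{s},\mathsf{f})\ge u_i((\mathsf{s}_{-i},s_i'),\mathsf{f})$; and (2) $\mathsf{f}(\mathsf{t},\cdot)$ is a client equilibrium for every $\mathsf{t}\in[0,1]^n$. Induced client equilibrium: after renaming facilities so that $s_1\le\dots\le s_n$, a client equilibrium is proper if $[0,1]$ is partitioned (up to endpoints) into consecutive intervals $[\beta_{i-1},\beta_i]$, $\beta_0=0$, $\beta_n=1$, with facility $i$ serving $[\beta_{i-1},\beta_i]$. It is assumed that for every location vector the clients are in the unique proper client equilibrium (for $\alpha>0$ all client equilibria for a given location vector induce the same loads). For $\alpha=0$, where clients are indifferent between co-located facilities, co-located facilities share equally the interval of clients nearest to their common location. *)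

theory Defs
  imports "HOL-Analysis.Analysis" "HOL-Library.FuncSet" "HOL-Library.Disjoint_Sets"
    "HOL-Combinatorics.Permutations"
begin

text \<open>
  Facilities are the numbers 1, ..., n and clients the reals in [0,1].  A location vector is
  an extensional function on the facilities, so that equality of location vectors is equality
  of their n coordinates.
\<close>

definition location_vectors :: "nat \<Rightarrow> (nat \<Rightarrow> real) set" where
  "location_vectors n = {1..n} \<rightarrow>\<^sub>E {0..1}"

definition clients_of :: "(nat \<Rightarrow> real) \<Rightarrow> ((nat \<Rightarrow> real) \<Rightarrow> real \<Rightarrow> nat) \<Rightarrow> nat \<Rightarrow> real set" where
  "clients_of s f i = {z \<in> {0..1}. f s z = i}"

text \<open>The predicate \<open>is_interval\<close> covers open, half-open, closed and one-point intervals.\<close>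

definition finite_interval_union :: "real set \<Rightarrow> bool" where
  "finite_interval_union A \<longleftrightarrow>
     (\<exists>\<I>. finite \<I> \<and> disjoint \<I> \<and> (\<forall>I\<in>\<I>. is_interval I) \<and> A = \<Union>\<I>)"

definition client_mapping :: "nat \<Rightarrow> ((nat \<Rightarrow> real) \<Rightarrow> real \<Rightarrow> nat) \<Rightarrow> bool" where
  "client_mapping n f \<longleftrightarrow>
     (\<forall>s\<in>location_vectors n.
        (\<forall>z\<in>{0..1}. f s z \<in> {1..n}) \<and>
        (\<forall>i\<in>{1..n}. finite_interval_union (clients_of s f i)))"

definition load :: "(nat \<Rightarrow> real) \<Rightarrow> ((nat \<Rightarrow> real) \<Rightarrow> real \<Rightarrow> nat) \<Rightarrow> nat \<Rightarrow> real" where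
  "load s f i = measure lborel (clients_of s f i)"

definition client_cost ::
    "real \<Rightarrow> (nat \<Rightarrow> real) \<Rightarrow> ((nat \<Rightarrow> real) \<Rightarrow> real \<Rightarrow> nat) \<Rightarrow> real \<Rightarrow> real" where
  "client_cost \<alpha> s f z = (1 - \<alpha>) * \<bar>s (f s z) - z\<bar> + \<alpha> * load s f (f s z)"

definition utility :: "(nat \<Rightarrow> real) \<Rightarrow> ((nat \<Rightarrow> real) \<Rightarrow> real \<Rightarrow> nat) \<Rightarrow> nat \<Rightarrow> real" where
  "utility s f i = load s f i"

text \<open>A single client has measure zero, so the loads do not change when one client switches.\<close>

definition client_equilibrium ::
    "nat \<Rightarrow> real \<Rightarrow> (nat \<Rightarrow> real) \<Rightarrow> ((nat \<Rightarrow> real) \<Rightarrow> real \<Rightarrow> nat) \<Rightarrow> bool" where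
  "client_equilibrium n \<alpha> t f \<longleftrightarrow>
     (\<forall>z\<in>{0..1}. \<forall>j\<in>{1..n}.
        client_cost \<alpha> t f z \<le> (1 - \<alpha>) * \<bar>t j - z\<bar> + \<alpha> * load t f j)"

definition SPE ::
    "nat \<Rightarrow> real \<Rightarrow> real \<Rightarrow> (nat \<Rightarrow> real) \<Rightarrow> ((nat \<Rightarrow> real) \<Rightarrow> real \<Rightarrow> nat) \<Rightarrow> bool" where
  "SPE n \<alpha> \<rho> s f \<longleftrightarrow>
     s \<in> location_vectors n \<and> client_mapping n f \<and>
     (\<forall>i\<in>{1..n}. \<forall>x\<in>{0..1}. \<rho> * utility s f i \<ge> utility (s(i := x)) f i) \<and>
     (\<forall>t\<in>location_vectors n. client_equilibrium n \<alpha> t f)"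

text \<open>
  The permutation \<open>\<pi>\<close> is the renaming that sorts the facilities by location (facility \<open>\<pi> i\<close> is
  the \<open>i\<close>-th from the left); among co-located facilities any order is allowed.  Boundary
  clients \<open>\<beta> i\<close> are unconstrained here beyond the equilibrium condition.
\<close>

definition proper_client_equilibrium ::
    "nat \<Rightarrow> real \<Rightarrow> (nat \<Rightarrow> real) \<Rightarrow> ((nat \<Rightarrow> real) \<Rightarrow> real \<Rightarrow> nat) \<Rightarrow> bool" where
  "proper_client_equilibrium n \<alpha> s f \<longleftrightarrow>
     client_equilibrium n \<alpha> s f \<and>
     (\<exists>\<pi> \<beta>. \<pi> permutes {1..n} \<and> mono_on {1..n} (s \<circ> \<pi>) \<and>
        \<beta> 0 = 0 \<and> \<beta> n = 1 \<and>
        (\<forall>i\<in>{1..n}. \<beta> (i - 1) \<le> \<beta> i \<and> (\<forall>z\<in>{\<beta> (i - 1)<..<\<beta> i}. f s z = \<pi> i)))"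

text \<open>
  For \<open>\<alpha> = 0\<close> properness alone does not determine how co-located facilities divide the
  interval of clients nearest to them; they share it equally.
\<close>

definition induced_client_mapping ::
    "nat \<Rightarrow> real \<Rightarrow> ((nat \<Rightarrow> real) \<Rightarrow> real \<Rightarrow> nat) \<Rightarrow> bool" where
  "induced_client_mapping n \<alpha> f \<longleftrightarrow>
     client_mapping n f \<and>
     (\<forall>s\<in>location_vectors n.
        proper_client_equilibrium n \<alpha> s f \<and>
        (\<alpha> = 0 \<longrightarrow> (\<forall>i\<in>{1..n}. \<forall>j\<in>{1..n}. s i = s j \<longrightarrow> load s f i = load s f j)))"

definition s_opt :: "nat \<Rightarrow> nat \<Rightarrow> real" where
  "s_opt n = (\<lambda>i\<in>{1..n}. (2 * real i - 1) / (2 * real n))"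

definition \<rho>\<^sub>4 :: "real \<Rightarrow> real" where
  "\<rho>\<^sub>4 \<alpha> = 1/2 + 2*(\<alpha>^2 - 2) / ((\<alpha> - 1)*\<alpha>*(4 + \<alpha>) - 4)"

definition \<rho>\<^sub>5 :: "real \<Rightarrow> real" where
  "\<rho>\<^sub>5 \<alpha> = (12 + \<alpha>*(4 + \<alpha>*(\<alpha>*(\<alpha> - 2) - 10)))
        / (8 + \<alpha>*(2 + \<alpha>)*(4 + (\<alpha> - 6)*\<alpha>))"

definition \<rho>\<^sub>6 :: "real \<Rightarrow> real" where
  "\<rho>\<^sub>6 \<alpha> = 1/2 + (16 - 16*\<alpha>^2 + 3*\<alpha>^4)
        / (16 + \<alpha>*(16 + \<alpha>*(\<alpha>*(\<alpha>*(5 + \<alpha>) - 12) - 20)))"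

definition \<rho>\<^sub>7 :: "real \<Rightarrow> real" where
  "\<rho>\<^sub>7 \<alpha> = (\<alpha>*(\<alpha>*(64 + \<alpha>*(16 + \<alpha>*(\<alpha>*(\<alpha> - 3) - 21))) - 16) - 48)
        / (\<alpha>*(\<alpha>*(48 + \<alpha>*(32 + \<alpha>*((\<alpha> - 6)*\<alpha> - 18))) - 32) - 32)"

definition \<rho>\<^sub>8 :: "real \<Rightarrow> real" where
  "\<rho>\<^sub>8 \<alpha> = 1/2 + 4*(\<alpha>^2 - 2)*(8 - 8*\<alpha>^2 + \<alpha>^4)
        / (\<alpha>*((\<alpha> - 2)*\<alpha>*(2 + \<alpha>)*(\<alpha>*(\<alpha>*(7 + \<alpha>) - 20) - 28) - 64) - 64)"

definition \<rho>\<^sub>9 :: "real \<Rightarrow> real" where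
  "\<rho>\<^sub>9 \<alpha> = (192 + \<alpha>*(64 + \<alpha>*(\<alpha>*(4 + \<alpha>)*(\<alpha>*(56 + \<alpha>*((\<alpha> - 8)*\<alpha> - 4)) - 24) - 352)))
        / (128 + (\<alpha> - 2)*\<alpha>*(\<alpha>*(2 + \<alpha>)*(48 + \<alpha>*(48 + \<alpha>*((\<alpha> - 8)*\<alpha> - 28))) - 64))"

definition \<rho>\<^sub>1\<^sub>0 :: "real \<Rightarrow> real" where
  "\<rho>\<^sub>1\<^sub>0 \<alpha> = 1/2 + (256 - 512*\<alpha>^2 + 336*\<alpha>^4 - 80*\<alpha>^6 + 5*\<alpha>^8)
        / (256 + \<alpha>*(256 + \<alpha>*(\<alpha>*(\<alpha>*(432 + \<alpha>*(240 + \<alpha>*(\<alpha>*(9*\<alpha> + \<alpha>^2 - 40) - 120))) - 448)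
             - 576)))"

definition rho :: "nat \<Rightarrow> real \<Rightarrow> real" where
  "rho n \<alpha> =
    (if n = 4 then \<rho>\<^sub>4 \<alpha> else if n = 5 then \<rho>\<^sub>5 \<alpha> else if n = 6 then \<rho>\<^sub>6 \<alpha>
     else if n = 7 then \<rho>\<^sub>7 \<alpha> else if n = 8 then \<rho>\<^sub>8 \<alpha> else if n = 9 then \<rho>\<^sub>9 \<alpha>
     else if n = 10 then \<rho>\<^sub>1\<^sub>0 \<alpha> else undefined)"

end

theory Submission
  imports Defs
begin

text \<open>
  For \<open>\<alpha> > 0\<close> every facility serves a nondegenerate interval, so the clients at the boundaries
  \<open>\<beta>\<^sub>i\<close> are indifferent between the neighbouring facilities.  Suppose the facility at sorted position \<open>p\<close> has
  deviated to \<open>x\<close> and serves the interval from \<open>\<beta>\<^bsub>p-1\<^esub>\<close> to \<open>\<beta>\<^sub>p\<close>, of length \<open>1/n + e\<close> with \<open>e > 0\<close>.  By reflection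
  it has moved right, so the facilities to its right stand at their optimal sites.  Loads
  propagate monotonically away from a boundary that is displaced from \<open>i/n\<close>, which forces
  \<open>\<beta>\<^bsub>p-1\<^esub> \<ge> (p-1)/n\<close> (or the mirrored situation), so \<open>\<beta>\<^sub>p = p/n + \<delta>\<close> with \<open>\<delta> \<ge> e\<close>.  The displacements
  of the boundaries further right decay at least like a continued fraction, hence the right neighbour has
  load at most \<open>1/n - c \<delta>\<close>.  The client at \<open>\<beta>\<^sub>p\<close> then gives
  \<open>\<alpha> e + \<alpha> c \<delta> \<le> (1 - \<alpha>) (1/(2n) - \<delta>)\<close>, that is \<open>n e \<le> (1 - \<alpha>) / (2 (1 + \<alpha> c))\<close>; the extreme
  value of \<open>c\<close> turns \<open>1 + n e\<close> into \<open>\<rho>\<^sub>n\<close>.  For \<open>\<alpha> = 0\<close> clients use a nearest facility and the bound \<open>3/(2n)\<close>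
  is read off from the distances between the sites.
\<close>

subsection \<open>Balanced divisions of the unit interval\<close>

text \<open>The optimal sites without the restriction to the index range, so that algebra with
  \<open>Suc j\<close> has no range conditions.\<close>

definition site :: "nat \<Rightarrow> nat \<Rightarrow> real" where
  "site n i = (2 * real i - 1) / (2 * real n)"

text \<open>The equation is the indifference of the client at \<open>\<beta> i\<close> between its
  two neighbours, with loads written as differences of boundaries. The client mapping is gone, so
  the estimates concern two real sequences only.\<close>

definition balanced :: "nat \<Rightarrow> real \<Rightarrow> (nat \<Rightarrow> real) \<Rightarrow> (nat \<Rightarrow> real) \<Rightarrow> bool" where
  "balanced n \<alpha> y \<beta> \<longleftrightarrow>
     mono_on {1..n} y \<and> \<beta> 0 = 0 \<and> \<beta> n = 1 \<and>
     (\<forall>i. 1 \<le> i \<and> i < n \<longrightarrow>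
        (1 - \<alpha>) * (\<bar>y i - \<beta> i\<bar> - \<bar>y (Suc i) - \<beta> i\<bar>)
          = \<alpha> * ((\<beta> (Suc i) - \<beta> i) - (\<beta> i - \<beta> (i - 1))))"

lemma balancedD:
  assumes "balanced n \<alpha> y \<beta>" "1 \<le> i" "i < n"
  shows "(1 - \<alpha>) * (\<bar>y i - \<beta> i\<bar> - \<bar>y (Suc i) - \<beta> i\<bar>)
          = \<alpha> * ((\<beta> (Suc i) - \<beta> i) - (\<beta> i - \<beta> (i - 1)))"
    and "y i \<le> y (Suc i)"
  using assms by (auto simp: balanced_def monotone_on_def)

lemma balanced_ends:
  assumes "balanced n \<alpha> y \<beta>" shows "\<beta> 0 = 0" "\<beta> n = 1"
  using assms by (auto simp: balanced_def)

text \<open>The reflection of the line turns facility \<open>i\<close> into \<open>Suc n - i\<close>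
  and boundary \<open>i\<close> into \<open>n - i\<close>. It transfers every estimate for one side
  to the other.\<close>

lemma balanced_mirror:
  assumes "balanced n \<alpha> y \<beta>"
  shows "balanced n \<alpha> (\<lambda>i. 1 - y (Suc n - i)) (\<lambda>i. 1 - \<beta> (n - i))"
  unfolding balanced_def
proof (intro conjI allI impI)
  show "mono_on {1..n} (\<lambda>i. 1 - y (Suc n - i))"
  proof (rule mono_onI)
    fix i j assume ij: "i \<in> {1..n}" "j \<in> {1..n}" "i \<le> j"
    have "mono_on {1..n} y" using assms by (simp add: balanced_def)
    moreover have "Suc n - j \<in> {1..n}" "Suc n - i \<in> {1..n}" "Suc n - j \<le> Suc n - i"
      using ij by auto
    ultimately have "y (Suc n - j) \<le> y (Suc n - i)" by (rule mono_onD)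
    then show "1 - y (Suc n - i) \<le> 1 - y (Suc n - j)" by simp
  qed
  fix i assume i: "1 \<le> i \<and> i < n"
  then have e: "Suc n - i = Suc (n - i)" "n - Suc i = n - i - 1" "n - (i - 1) = Suc (n - i)"
    by auto
  have "(1 - \<alpha>) * (\<bar>y (n - i) - \<beta> (n - i)\<bar> - \<bar>y (Suc (n - i)) - \<beta> (n - i)\<bar>)
      = \<alpha> * ((\<beta> (Suc (n - i)) - \<beta> (n - i)) - (\<beta> (n - i) - \<beta> (n - i - 1)))"
    using balancedD(1)[OF assms, of "n - i"] i by auto
  then show "(1 - \<alpha>) * (\<bar>1 - y (Suc n - i) - (1 - \<beta> (n - i))\<bar> - \<bar>1 - y (Suc n - Suc i) - (1 - \<beta> (n - i))\<bar>) =
         \<alpha> * (1 - \<beta> (n - Suc i) - (1 - \<beta> (n - i)) - (1 - \<beta> (n - i) - (1 - \<beta> (n - (i - 1)))))"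
    unfolding diff_Suc_Suc e by (simp add: abs_minus_commute algebra_simps)
qed (use assms in \<open>auto simp: balanced_def\<close>)

text \<open>A boundary client right of the midpoint is no farther from the right facility, so
  indifference requires the right load to be no smaller; likewise on the left.\<close>

lemma piece_mono_at_boundary:
  assumes "balanced n \<alpha> y \<beta>" "0 < \<alpha>" "\<alpha> \<le> 1" "1 \<le> i" "i < n"
  shows "(y i + y (Suc i)) / 2 \<le> \<beta> i \<Longrightarrow> \<beta> i - \<beta> (i - 1) \<le> \<beta> (Suc i) - \<beta> i"
    and "\<beta> i \<le> (y i + y (Suc i)) / 2 \<Longrightarrow> \<beta> (Suc i) - \<beta> i \<le> \<beta> i - \<beta> (i - 1)"
proof -
  note b = balancedD[OF assms(1,4,5)]
  show "\<beta> i - \<beta> (i - 1) \<le> \<beta> (Suc i) - \<beta> i" if "(y i + y (Suc i)) / 2 \<le> \<beta> i"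
  proof -
    have "0 \<le> \<bar>y i - \<beta> i\<bar> - \<bar>y (Suc i) - \<beta> i\<bar>" using that b(2) by (auto simp: abs_if)
    then have "0 \<le> \<alpha> * ((\<beta> (Suc i) - \<beta> i) - (\<beta> i - \<beta> (i - 1)))"
      using b(1) assms(3) by (metis diff_ge_0_iff_ge mult_nonneg_nonneg)
    then show ?thesis using assms(2) by (simp add: zero_le_mult_iff)
  qed
  show "\<beta> (Suc i) - \<beta> i \<le> \<beta> i - \<beta> (i - 1)" if "\<beta> i \<le> (y i + y (Suc i)) / 2"
  proof -
    have "\<bar>y i - \<beta> i\<bar> - \<bar>y (Suc i) - \<beta> i\<bar> \<le> 0" using that b(2) by (auto simp: abs_if)
    then have "\<alpha> * ((\<beta> (Suc i) - \<beta> i) - (\<beta> i - \<beta> (i - 1))) \<le> 0"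
      using b(1) assms(3) by (metis diff_ge_0_iff_ge mult_nonneg_nonpos)
    then show ?thesis using assms(2) by (simp add: mult_le_0_iff)
  qed
qed

text \<open>Otherwise boundary \<open>Suc i\<close> also overshoots its cell, hence its midpoint, so
  the next piece is at least as long; this repeats up to boundary \<open>n\<close>, which would
  exceed 1. The inequality in \<open>mid\<close> matters for the mirrored version: after a right
  move the midpoints left of the deviator can lie right of \<open>j/n\<close>.\<close>

lemma next_piece_small:
  assumes b: "balanced n \<alpha> y \<beta>" and \<alpha>: "0 < \<alpha>" "\<alpha> \<le> 1" and i: "i < n"
    and mid: "\<forall>j\<in>{i<..<n}. (y j + y (Suc j)) / 2 \<le> real j / real n"
    and over: "real i / real n < \<beta> i"
  shows "\<beta> (Suc i) - \<beta> i < 1 / real n"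
proof (rule ccontr)
  assume large: "\<not> ?thesis"
  have "real j / real n < \<beta> j \<and> 1 / real n \<le> \<beta> j - \<beta> (j - 1)"
    if "Suc i \<le> j" "j \<le> n" for j
    using that
  proof (induction j rule: dec_induct)
    case base
    then show ?case using large over by (simp add: add_divide_distrib)
  next
    case (step j)
    then have h: "real j / real n < \<beta> j" "1 / real n \<le> \<beta> j - \<beta> (j - 1)" by auto
    moreover have "\<beta> j - \<beta> (j - 1) \<le> \<beta> (Suc j) - \<beta> j"
    proof (rule piece_mono_at_boundary(1)[OF b \<alpha>])
      show "(y j + y (Suc j)) / 2 \<le> \<beta> j"
        using step h by (intro order.trans[OF bspec[OF mid] less_imp_le]) auto
    qed (use step in auto)
    ultimately show ?case by (simp add: add_divide_distrib)
  qed
  from this[of n] show False using i balanced_ends[OF b] by auto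
qed

lemma previous_piece_small:
  assumes b: "balanced n \<alpha> y \<beta>" and \<alpha>: "0 < \<alpha>" "\<alpha> \<le> 1" and i: "1 \<le> i" "i \<le> n"
    and mid: "\<forall>j\<in>{1..<i}. real j / real n \<le> (y j + y (Suc j)) / 2"
    and under: "\<beta> i < real i / real n"
  shows "\<beta> i - \<beta> (i - 1) < 1 / real n"
proof -
  \<comment> \<open>Boundary \<open>i\<close> is boundary \<open>n - i\<close> of the mirror image,
    so the piece left of it becomes piece \<open>Suc (n - i)\<close>.\<close>
  have "1 - \<beta> (n - Suc (n - i)) - (1 - \<beta> (n - (n - i))) < 1 / real n"
  proof (rule next_piece_small[OF balanced_mirror[OF b] \<alpha>])
    show "\<forall>j\<in>{n - i<..<n}. (1 - y (Suc n - j) + (1 - y (Suc n - Suc j))) / 2 \<le> real j / real n"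
    proof
      fix j assume j: "j \<in> {n - i<..<n}"
      then have "real (n - j) / real n = 1 - real j / real n"
        by (simp add: of_nat_diff diff_divide_distrib)
      moreover have "real (n - j) / real n \<le> (y (n - j) + y (Suc (n - j))) / 2"
        by (rule bspec[OF mid]) (use j i in auto)
      ultimately show "(1 - y (Suc n - j) + (1 - y (Suc n - Suc j))) / 2 \<le> real j / real n"
        using j by (simp add: Suc_diff_le)
    qed
  qed (use i under in \<open>auto simp: of_nat_diff diff_divide_distrib\<close>)
  then show ?thesis using i by simp
qed

subsection \<open>Decay of boundary displacements\<close>

text \<open>Solving \<open>2 e_(j+1) = \<alpha> (e_j + e_(j+2))\<close> backwards from
  \<open>e_n = 0\<close> gives \<open>e_(j+1) = decay \<alpha> m * e_j\<close> with
  \<open>m = n - Suc j\<close>, the number of boundaries still to come.\<close>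

fun decay :: "real \<Rightarrow> nat \<Rightarrow> real" where
  "decay \<alpha> 0 = 0"
| "decay \<alpha> (Suc m) = \<alpha> / (2 - \<alpha> * decay \<alpha> m)"

lemma decay_bounds:
  assumes "0 \<le> \<alpha>" "\<alpha> \<le> 1" shows "0 \<le> decay \<alpha> m" "decay \<alpha> m \<le> 1"
proof -
  have "0 \<le> decay \<alpha> m \<and> decay \<alpha> m \<le> 1"
  proof (induction m)
    case (Suc m)
    then have "\<alpha> * decay \<alpha> m \<le> 1" using assms mult_le_one by blast
    then show ?case using assms by (simp add: divide_le_eq)
  qed simp
  then show "0 \<le> decay \<alpha> m" "decay \<alpha> m \<le> 1" by auto
qed

lemma decay_denominator_pos:
  assumes "0 \<le> \<alpha>" "\<alpha> \<le> 1" shows "0 < 2 - \<alpha> * decay \<alpha> m"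
  using mult_le_one[OF assms(2) decay_bounds[OF assms], of m] by simp

lemma decay_Suc_mono:
  assumes "0 \<le> \<alpha>" "\<alpha> \<le> 1" shows "decay \<alpha> m \<le> decay \<alpha> (Suc m)"
proof (induction m)
  case 0 show ?case using assms by simp
next
  case (Suc m)
  then have "\<alpha> * decay \<alpha> m \<le> \<alpha> * decay \<alpha> (Suc m)" using assms(1) by (rule mult_left_mono)
  then have "\<alpha> / (2 - \<alpha> * decay \<alpha> m) \<le> \<alpha> / (2 - \<alpha> * decay \<alpha> (Suc m))"
    using decay_denominator_pos[OF assms, of "Suc m"] assms by (intro frac_le) auto
  then show ?case by simp
qed

lemma decay_mono:
  assumes "0 \<le> \<alpha>" "\<alpha> \<le> 1" "m \<le> m'" shows "decay \<alpha> m \<le> decay \<alpha> m'"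
  using assms(3) by (rule lift_Suc_mono_le[of "decay \<alpha>", OF decay_Suc_mono[OF assms(1,2)]])

lemma site_Suc: "0 < n \<Longrightarrow> site n (Suc j) = site n j + 1 / real n"
  by (simp add: site_def field_simps)

lemma site_mid: "0 < n \<Longrightarrow> (site n j + site n (Suc j)) / 2 = real j / real n"
  by (simp add: site_def field_simps)

lemma site_mirror: "0 < n \<Longrightarrow> 1 \<le> j \<Longrightarrow> j \<le> n \<Longrightarrow> 1 - site n (Suc n - j) = site n j"
  by (simp add: site_def field_simps of_nat_diff)

text \<open>At a first violation the piece ending there is longer than \<open>1/n\<close>, since its
  left end is not beyond its own next site. The following piece is shorter than \<open>1/n\<close>,
  although the boundary lies right of the midpoint, where lengths cannot drop. The lemma fixes the
  sign of one absolute value in the decay estimate.\<close>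

lemma boundary_before_next_site:
  assumes b: "balanced n \<alpha> y \<beta>" and \<alpha>: "0 < \<alpha>" "\<alpha> \<le> 1" and i: "i < n"
    and std: "\<forall>j\<in>{i<..n}. y j = site n j"
    and start: "\<beta> i \<le> y (Suc i)"
    and j: "i \<le> j" "j < n"
  shows "\<beta> j \<le> y (Suc j)"
  using j
proof (induction j rule: dec_induct)
  case base show ?case by (rule start)
next
  case (step j)
  have n: "0 < n" using i by auto
  have "site n (Suc j) \<le> site n (Suc (Suc j))" using site_Suc[OF n, of "Suc j"] by simp
  show ?case
  proof (rule ccontr)
    assume "\<not> ?case"
    then have over: "site n (Suc (Suc j)) < \<beta> (Suc j)" using std step by simp
    then have "real (Suc j) / real n < \<beta> (Suc j)"
      using n by (simp add: site_def field_simps)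
    then have "\<beta> (Suc (Suc j)) - \<beta> (Suc j) < 1 / real n"
      using step std site_mid[OF n] by (intro next_piece_small[OF b \<alpha>]) auto
    moreover have "\<beta> (Suc j) - \<beta> (Suc j - 1) \<le> \<beta> (Suc (Suc j)) - \<beta> (Suc j)"
      using over step std \<open>site n (Suc j) \<le> site n (Suc (Suc j))\<close>
      by (intro piece_mono_at_boundary(1)[OF b \<alpha>]) auto
    ultimately show False
      using over step std site_Suc[OF n, of "Suc j"] by simp
  qed
qed

text \<open>
  The displacements \<open>\<epsilon>\<^sub>j = \<beta>\<^sub>j - j/n\<close> satisfy \<open>\<alpha> (\<epsilon>\<^bsub>j+1\<^esub> - 2 \<epsilon>\<^sub>j + \<epsilon>\<^bsub>j-1\<^esub>) \<ge> 2 (1 - \<alpha>) \<epsilon>\<^sub>j\<close> and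
  \<open>\<epsilon>\<^sub>n = 0\<close>; solving from the right end gives the continued fraction \<open>decay\<close>.
\<close>

lemma displacement_decay:
  assumes b: "balanced n \<alpha> y \<beta>" and \<alpha>: "0 < \<alpha>" "\<alpha> \<le> 1" and i: "i < n"
    and std: "\<forall>j\<in>{i<..n}. y j = site n j"
    and start: "\<beta> i \<le> y (Suc i)"
  shows "\<beta> (Suc i) - real (Suc i) / real n
      \<le> decay \<alpha> (n - Suc i) * (\<beta> i - real i / real n)"
proof -
  define \<epsilon> where "\<epsilon> j = \<beta> j - real j / real n" for j
  have n: "0 < n" using i by simp
  have "\<epsilon> (Suc j) \<le> decay \<alpha> (n - Suc j) * \<epsilon> j" if "i \<le> j" "j < n" for j
    using \<open>j < n\<close> \<open>i \<le> j\<close>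
  proof (induction j rule: strict_inc_induct)
    case (base j)
    then show ?case using balanced_ends[OF b] n by (simp add: \<epsilon>_def)
  next
    case (step j)
    have IH: "\<epsilon> (Suc (Suc j)) \<le> decay \<alpha> (n - Suc (Suc j)) * \<epsilon> (Suc j)" using step by simp
    have lt: "Suc j < n" using step by simp
    have "\<beta> (Suc j) \<le> y (Suc (Suc j))"
      using boundary_before_next_site[OF b \<alpha> i std start, of "Suc j"] step lt by simp
    moreover have "y (Suc j) + y (Suc (Suc j)) = 2 * (real (Suc j) / real n)"
      using std step.prems lt site_mid[OF n, of "Suc j"] by simp
    \<comment> \<open>Only the absolute value of the right distance is resolved; the left one is
      bounded below by \<open>\<beta> (Suc j) - y (Suc j)\<close>, on whichever side the boundary
      lies.\<close>
    ultimately have "2 * \<epsilon> (Suc j) \<le> \<bar>y (Suc j) - \<beta> (Suc j)\<bar> - \<bar>y (Suc (Suc j)) - \<beta> (Suc j)\<bar>"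
      unfolding \<epsilon>_def by (smt (verit))
    then have "(1 - \<alpha>) * (2 * \<epsilon> (Suc j))
        \<le> (1 - \<alpha>) * (\<bar>y (Suc j) - \<beta> (Suc j)\<bar> - \<bar>y (Suc (Suc j)) - \<beta> (Suc j)\<bar>)"
      using \<alpha> by (intro mult_left_mono) auto
    also have "\<dots> = \<alpha> * (\<epsilon> (Suc (Suc j)) - 2 * \<epsilon> (Suc j) + \<epsilon> j)"
      using balancedD(1)[OF b, of "Suc j"] lt
      by (simp add: \<epsilon>_def add_divide_distrib algebra_simps)
    finally have "2 * \<epsilon> (Suc j) \<le> \<alpha> * \<epsilon> j + \<alpha> * \<epsilon> (Suc (Suc j))"
      by (simp add: algebra_simps)
    also have "\<alpha> * \<epsilon> (Suc (Suc j)) \<le> \<alpha> * (decay \<alpha> (n - Suc (Suc j)) * \<epsilon> (Suc j))"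
      using IH \<alpha> by (intro mult_left_mono) auto
    finally have "(2 - \<alpha> * decay \<alpha> (n - Suc (Suc j))) * \<epsilon> (Suc j) \<le> \<alpha> * \<epsilon> j"
      by (simp add: algebra_simps)
    moreover have "n - Suc j = Suc (n - Suc (Suc j))" using lt by simp
    ultimately show ?case
      using decay_denominator_pos[of \<alpha> "n - Suc (Suc j)"] \<alpha>
      by (simp add: pos_le_divide_eq mult.commute)
  qed
  then show ?thesis using i by (simp add: \<epsilon>_def)
qed

subsection \<open>The load of a deviating facility\<close>

text \<open>This is \<open>n\<close> times the bound on the load of a deviator. The index
  \<open>n - 2\<close> is \<open>n - Suc p\<close> at the leftmost position \<open>p = 1\<close>,
  where \<open>decay\<close> is largest.\<close>

definition gain :: "nat \<Rightarrow> real \<Rightarrow> real" where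
  "gain n \<alpha> = 1 + (1 - \<alpha>) / (2 * (1 + \<alpha> * (1 - decay \<alpha> (n - 2))))"

lemma gain_ge_1: "0 \<le> \<alpha> \<Longrightarrow> \<alpha> \<le> 1 \<Longrightarrow> 1 \<le> gain n \<alpha>"
  using decay_bounds[of \<alpha> "n - 2"] by (simp add: gain_def)

lemma piece_bound_if_left_end_right_of_cell:
  assumes b: "balanced n \<alpha> y \<beta>" and \<alpha>: "0 < \<alpha>" "\<alpha> \<le> 1" and p: "1 \<le> p" "p \<le> n"
    and std: "\<forall>j\<in>{p<..n}. y j = site n j"
    and left: "real (p - 1) / real n \<le> \<beta> (p - 1)"
  shows "\<beta> p - \<beta> (p - 1) \<le> gain n \<alpha> / real n"
proof (rule ccontr)
  assume "\<not> ?thesis"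
  then have big: "gain n \<alpha> / real n < \<beta> p - \<beta> (p - 1)" by simp
  have n: "0 < n" using p by simp
  have "1 / real n \<le> gain n \<alpha> / real n" using gain_ge_1[of \<alpha> n] \<alpha> by (intro divide_right_mono) auto
  then have big1: "1 / real n < \<beta> p - \<beta> (p - 1)" using big by simp
  define \<delta> where "\<delta> = \<beta> p - real p / real n"
  define e where "e = \<beta> p - \<beta> (p - 1) - 1 / real n"
  have e\<delta>: "e \<le> \<delta>" "0 < e"
    using left big1 p by (auto simp: e_def \<delta>_def of_nat_diff diff_divide_distrib)
  have "p \<noteq> n"
    using e\<delta> balanced_ends[OF b] n by (auto simp: \<delta>_def)
  then have lt: "p < n" using p by simp
  have small: "\<beta> (Suc p) - \<beta> p < 1 / real n"
    using e\<delta> std site_mid[OF n] by (intro next_piece_small[OF b \<alpha> lt]) (auto simp: \<delta>_def)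
  \<comment> \<open>The next piece is shorter than this one, so the boundary lies left of the
    midpoint and hence left of the right neighbour.\<close>
  have le: "\<beta> p \<le> y (Suc p)"
    using piece_mono_at_boundary(1)[OF b \<alpha> p(1) lt] balancedD(2)[OF b p(1) lt] small big1
    by argo
  define c where "c = decay \<alpha> (n - Suc p)"
  have c: "0 \<le> c" "c \<le> 1" "c \<le> decay \<alpha> (n - 2)"
    using decay_bounds[of \<alpha>] decay_mono[of \<alpha> "n - Suc p" "n - 2"] \<alpha> p
    by (auto simp: c_def)
  have ch: "\<beta> (Suc p) - \<beta> p - 1 / real n \<le> - (1 - c) * \<delta>"
    using displacement_decay[OF b \<alpha> lt std le] n
    by (simp add: c_def \<delta>_def field_simps)
  \<comment> \<open>Dropping the deviator's own distance corresponds to its best choice, standing on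
    the boundary itself.\<close>
  have "(1 - \<alpha>) * (- (y (Suc p) - \<beta> p)) \<le> (1 - \<alpha>) * (\<bar>y p - \<beta> p\<bar> - \<bar>y (Suc p) - \<beta> p\<bar>)"
    using le \<alpha> by (intro mult_left_mono) auto
  also have "\<dots> = \<alpha> * (\<beta> (Suc p) - \<beta> p - 1 / real n - e)"
    using balancedD(1)[OF b p(1) lt] by (simp add: e_def)
  also have "\<dots> \<le> \<alpha> * (- (1 - c) * \<delta> - e)"
    using ch \<alpha> by (intro mult_left_mono) auto
  also have "y (Suc p) = real p / real n + 1 / (2 * real n)"
    using bspec[OF std, of "Suc p"] lt n by (simp add: site_def field_simps)
  finally have "\<alpha> * e + (1 - \<alpha> + \<alpha> * (1 - c)) * \<delta> \<le> (1 - \<alpha>) / (2 * real n)"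
    by (simp add: \<delta>_def algebra_simps add_divide_distrib diff_divide_distrib)
  \<comment> \<open>Both factors are weakened: \<open>\<delta>\<close> to \<open>e\<close>, and
    \<open>c\<close> to the largest decay over all positions.\<close>
  moreover have "(1 - \<alpha> + \<alpha> * (1 - decay \<alpha> (n - 2))) * e \<le> (1 - \<alpha> + \<alpha> * (1 - c)) * \<delta>"
    using c e\<delta> \<alpha> decay_bounds[of \<alpha> "n - 2"]
    by (intro mult_mono add_nonneg_nonneg) (auto intro: add_left_mono mult_left_mono)
  ultimately have "(1 + \<alpha> * (1 - decay \<alpha> (n - 2))) * e \<le> (1 - \<alpha>) / (2 * real n)"
    by (simp add: algebra_simps)
  moreover have "0 < 1 + \<alpha> * (1 - decay \<alpha> (n - 2))"
    using \<alpha> decay_bounds[of \<alpha> "n - 2"] by (simp add: add_pos_nonneg)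
  ultimately have "e \<le> (1 - \<alpha>) / (2 * real n) / (1 + \<alpha> * (1 - decay \<alpha> (n - 2)))"
    by (metis pos_le_divide_eq mult.commute)
  also have "\<dots> = (gain n \<alpha> - 1) / real n"
    by (simp add: gain_def mult_ac)
  finally show False using big by (simp add: e_def diff_divide_distrib)
qed

lemma piece_bound_if_right_end_left_of_cell:
  assumes b: "balanced n \<alpha> y \<beta>" and \<alpha>: "0 < \<alpha>" "\<alpha> \<le> 1" and p: "1 \<le> p" "p \<le> n"
    and std: "\<forall>j\<in>{1..<p}. y j = site n j"
    and right: "\<beta> p \<le> real p / real n"
  shows "\<beta> p - \<beta> (p - 1) \<le> gain n \<alpha> / real n"
proof -
  have n: "0 < n" using p by simp
  have "1 - \<beta> (n - (Suc n - p)) - (1 - \<beta> (n - (Suc n - p - 1))) \<le> gain n \<alpha> / real n"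
  proof (rule piece_bound_if_left_end_right_of_cell[OF balanced_mirror[OF b] \<alpha>])
    show "\<forall>j\<in>{Suc n - p<..n}. 1 - y (Suc n - j) = site n j"
    proof
      fix j assume "j \<in> {Suc n - p<..n}"
      then show "1 - y (Suc n - j) = site n j"
        using std site_mirror[OF n, of j] p by (subst bspec[OF std]) auto
    qed
    show "real (Suc n - p - 1) / real n \<le> 1 - \<beta> (n - (Suc n - p - 1))"
      using right p n by (simp add: of_nat_diff diff_divide_distrib)
  qed (use p in auto)
  then show ?thesis using p by simp
qed

text \<open>The remaining case has its left end left of \<open>(p-1)/n\<close>. There a long piece
  forces \<open>p = k\<close>: a facility that has been passed would stand at site \<open>p\<close>,
  putting the midpoint too far right. By the mirrored bound the right end overshoots as well, and
  the two indifference conditions at the ends then contradict each other.\<close>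

lemma piece_bound_right_move:
  assumes b: "balanced n \<alpha> y \<beta>" and \<alpha>: "0 < \<alpha>" "\<alpha> \<le> 1" and k: "1 \<le> k" "k \<le> p" "p \<le> n"
    and left: "\<forall>j\<in>{1..<p}. y j = site n (if j < k then j else Suc j)"
    and right: "\<forall>j\<in>{p<..n}. y j = site n j"
  shows "\<beta> p - \<beta> (p - 1) \<le> gain n \<alpha> / real n"
proof (rule ccontr)
  assume big: "\<not> ?thesis"
  have n: "0 < n" using k by simp
  have p: "1 \<le> p" "p \<le> n" using k by auto
  have "1 / real n \<le> gain n \<alpha> / real n" using gain_ge_1[of \<alpha> n] \<alpha> by (intro divide_right_mono) auto
  then have big1: "1 / real n < \<beta> p - \<beta> (p - 1)" using big by simp
  have under: "\<beta> (p - 1) < real (p - 1) / real n"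
    using piece_bound_if_left_end_right_of_cell[OF b \<alpha> p right] big by argo
  then have "p \<noteq> 1" using balanced_ends[OF b] by auto
  then have p2: "1 \<le> p - 1" "p - 1 < n" "Suc (p - 1) = p" using p by auto
  have site_le: "site n j \<le> y j" if "1 \<le> j" "j < p" for j
    using left that n by (auto simp: site_def divide_right_mono)
  have small: "\<beta> (p - 1) - \<beta> (p - 1 - 1) < 1 / real n"
  proof (rule previous_piece_small[OF b \<alpha>])
    show "\<forall>j\<in>{1..<p - 1}. real j / real n \<le> (y j + y (Suc j)) / 2"
    proof
      fix j assume "j \<in> {1..<p - 1}"
      then have "1 \<le> j" "Suc j < p" by auto
      then show "real j / real n \<le> (y j + y (Suc j)) / 2"
        using site_le[of j] site_le[of "Suc j"] site_mid[OF n, of j] by auto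
    qed
  qed (use p2 under in auto)
  have mid: "\<beta> (p - 1) > (y (p - 1) + y p) / 2"
    using piece_mono_at_boundary(2)[OF b \<alpha> p2(1,2)] small big1 unfolding p2(3) by argo
  have mono: "y (p - 1) \<le> y p" using balancedD(2)[OF b p2(1,2)] p2(3) by simp
  have "p = k"
  proof (rule ccontr)
    assume "p \<noteq> k"
    then have "y (p - 1) = site n p" using left p2 k by auto
    moreover have "real (p - 1) / real n \<le> site n p"
      using n p by (simp add: site_def field_simps of_nat_diff)
    ultimately show False using mid mono under by argo
  qed
  then have std: "\<forall>j\<in>{1..<p}. y j = site n j" using left by auto
  have over: "real p / real n < \<beta> p"
    using piece_bound_if_right_end_left_of_cell[OF b \<alpha> p std] big by argo
  then have "p \<noteq> n" using balanced_ends[OF b] n by auto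
  then have lt: "p < n" using p by simp
  have small': "\<beta> (Suc p) - \<beta> p < 1 / real n"
    using over right site_mid[OF n] by (intro next_piece_small[OF b \<alpha> lt]) auto
  have le: "\<beta> p \<le> y (Suc p)"
    using piece_mono_at_boundary(1)[OF b \<alpha> p(1) lt] balancedD(2)[OF b p(1) lt] small' big1
    by argo
  have ge: "y (p - 1) \<le> \<beta> (p - 1)" using mid mono by argo
  have width: "y (Suc p) - y (p - 1) = 2 * (1 / real n)"
    using bspec[OF std, of "p - 1"] bspec[OF right, of "Suc p"] p2 lt n
    by (simp add: site_def field_simps of_nat_diff)
  have "0 \<le> (1 - \<alpha>) * (2 * (\<beta> p - \<beta> (p - 1) - 1 / real n))" using big1 \<alpha> by simp
  \<comment> \<open>The distances of \<open>y p\<close> to the two ends add up to at least the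
    length of the piece. The distances to the neighbours add up to \<open>2/n\<close> minus that
    length, as the neighbours are \<open>2/n\<close> apart and enclose the piece.\<close>
  also have "2 * (\<beta> p - \<beta> (p - 1) - 1 / real n)
     \<le> (\<bar>y p - \<beta> p\<bar> - \<bar>y (Suc p) - \<beta> p\<bar>) - (\<bar>y (p - 1) - \<beta> (p - 1)\<bar> - \<bar>y p - \<beta> (p - 1)\<bar>)"
    using le ge width by (smt (verit))
  also have "(1 - \<alpha>) * \<dots> = \<alpha> * ((\<beta> (Suc p) - \<beta> p) - (\<beta> p - \<beta> (p - 1)))
       - \<alpha> * ((\<beta> p - \<beta> (p - 1)) - (\<beta> (p - 1) - \<beta> (p - 1 - 1)))"
    using balancedD(1)[OF b p(1) lt] balancedD(1)[OF b p2(1,2)] p2(3)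
    by (simp add: right_diff_distrib)
  also have "\<dots> = \<alpha> * ((\<beta> (Suc p) - \<beta> p) - (\<beta> p - \<beta> (p - 1))
       - ((\<beta> p - \<beta> (p - 1)) - (\<beta> (p - 1) - \<beta> (p - 1 - 1))))"
    by (simp only: right_diff_distrib)
  \<comment> \<open>The middle piece is longer than \<open>1/n\<close> and both adjacent ones are
    shorter, so the second difference of the boundary increments is negative.\<close>
  also have "\<dots> < 0" using \<alpha> small small' big1 by (intro mult_pos_neg) auto
  finally show False using \<alpha> by (simp add: mult_left_mono)
qed

definition skip :: "nat \<Rightarrow> nat \<Rightarrow> nat" where
  "skip p i = (if i < p then i else Suc i)"

text \<open>With position \<open>p\<close> deleted from the sorted locations and site
  \<open>k\<close> from the sites, both lists agree. This describes every unilateral deviation,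
  leaving \<open>y p\<close> constrained by sortedness alone; \<open>p < k\<close> is a right move
  after reflection.\<close>

lemma piece_bound:
  assumes b: "balanced n \<alpha> y \<beta>" and \<alpha>: "0 < \<alpha>" "\<alpha> \<le> 1"
    and k: "k \<in> {1..n}" and p: "p \<in> {1..n}"
    and y: "\<And>i. i \<in> {1..<n} \<Longrightarrow> y (skip p i) = site n (skip k i)"
  shows "\<beta> p - \<beta> (p - 1) \<le> gain n \<alpha> / real n"
proof (cases "k \<le> p")
  case True
  show ?thesis
  proof (rule piece_bound_right_move[OF b \<alpha>, of k])
    show "\<forall>j\<in>{1..<p}. y j = site n (if j < k then j else Suc j)"
    proof
      fix j assume "j \<in> {1..<p}"
      then show "y j = site n (if j < k then j else Suc j)"
        using y[of j] p by (simp add: skip_def)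
    qed
    show "\<forall>j\<in>{p<..n}. y j = site n j"
    proof
      fix j assume j: "j \<in> {p<..n}"
      then show "y j = site n j" using y[of "j - 1"] p k True by (cases j) (auto simp: skip_def)
    qed
  qed (use k p True in auto)
next
  case False
  have n: "0 < n" using k by simp
  have "1 - \<beta> (n - (Suc n - p)) - (1 - \<beta> (n - (Suc n - p - 1))) \<le> gain n \<alpha> / real n"
  proof (rule piece_bound_right_move[OF balanced_mirror[OF b] \<alpha>, of "Suc n - k"])
    show "\<forall>j\<in>{1..<Suc n - p}. 1 - y (Suc n - j) = site n (if j < Suc n - k then j else Suc j)"
    proof
      fix j assume j: "j \<in> {1..<Suc n - p}"
      then have "skip p (n - j) = Suc n - j"
        and "skip k (n - j) = Suc n - (if j < Suc n - k then j else Suc j)"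
        using p k False by (auto simp: skip_def)
      then show "1 - y (Suc n - j) = site n (if j < Suc n - k then j else Suc j)"
        using y[of "n - j"] j p k False
          site_mirror[OF n, of "if j < Suc n - k then j else Suc j"]
        by (auto split: if_splits)
    qed
    show "\<forall>j\<in>{Suc n - p<..n}. 1 - y (Suc n - j) = site n j"
    proof
      fix j assume j: "j \<in> {Suc n - p<..n}"
      then have "Suc n - j \<in> {1..<n}"
        and "skip p (Suc n - j) = Suc n - j" "skip k (Suc n - j) = Suc n - j"
        using p k False by (auto simp: skip_def)
      then show "1 - y (Suc n - j) = site n j"
        using y[of "Suc n - j"] j site_mirror[OF n, of j] by auto
    qed
  qed (use k p False in auto)
  then show ?thesis using p by simp
qed

text \<open>Take the first displaced boundary. If it is too far left, the pieces can only shrink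
  from there on and the last boundary stays below 1. If it is too far right, the next piece is short
  although lengths cannot drop there.\<close>

lemma balanced_at_sites:
  assumes b: "balanced n \<alpha> y \<beta>" and \<alpha>: "0 < \<alpha>" "\<alpha> \<le> 1"
    and y: "\<And>j. j \<in> {1..n} \<Longrightarrow> y j = site n j" and i: "i \<le> n"
  shows "\<beta> i = real i / real n"
  using i
proof (induction i)
  case 0 show ?case using balanced_ends[OF b] by simp
next
  case (Suc i)
  then have IH: "\<beta> i = real i / real n" and n: "0 < n" by auto
  show ?case
  proof (rule ccontr)
    assume neq: "\<not> ?case"
    then have lt: "Suc i < n" using Suc balanced_ends[OF b] by (cases "Suc i = n") auto
    consider "\<beta> (Suc i) < real (Suc i) / real n" | "real (Suc i) / real n < \<beta> (Suc i)"
      using neq by linarith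
    then show False
    proof cases
      case 1
      have "\<beta> j < real j / real n \<and> \<beta> j - \<beta> (j - 1) < 1 / real n"
        if "Suc i \<le> j" "j \<le> n" for j
        using that
      proof (induction j rule: dec_induct)
        case base
        then show ?case using 1 IH by (simp add: add_divide_distrib)
      next
        case (step j)
        moreover have "\<beta> (Suc j) - \<beta> j \<le> \<beta> j - \<beta> (j - 1)"
          using step y[of j] y[of "Suc j"] site_mid[OF n, of j]
          by (intro piece_mono_at_boundary(2)[OF b \<alpha>]) auto
        ultimately show ?case by (auto simp: add_divide_distrib)
      qed
      from this[of n] show False using lt balanced_ends[OF b] n by auto
    next
      case 2
      have "\<beta> (Suc (Suc i)) - \<beta> (Suc i) < 1 / real n"
        using 2 lt y site_mid[OF n] by (intro next_piece_small[OF b \<alpha>]) auto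
      moreover have "\<beta> (Suc i) - \<beta> (Suc i - 1) \<le> \<beta> (Suc (Suc i)) - \<beta> (Suc i)"
        using 2 lt y[of "Suc i"] y[of "Suc (Suc i)"] site_mid[OF n, of "Suc i"]
        by (intro piece_mono_at_boundary(1)[OF b \<alpha>]) (auto simp del: of_nat_Suc)
      ultimately show False using 2 IH by (simp add: add_divide_distrib)
    qed
  qed
qed

subsection \<open>The ratios in closed form\<close>

text \<open>Continuants of the continued fraction \<open>decay\<close>; for positive
  \<open>\<alpha>\<close> they are the rescaled Chebyshev polynomials of the second kind
  \<open>\<alpha>^m * U_m(1/\<alpha>)\<close>.\<close>

fun decay_poly :: "real \<Rightarrow> nat \<Rightarrow> real" where
  "decay_poly \<alpha> 0 = 1"
| "decay_poly \<alpha> (Suc 0) = 2"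
| "decay_poly \<alpha> (Suc (Suc m)) = 2 * decay_poly \<alpha> (Suc m) - \<alpha>^2 * decay_poly \<alpha> m"

lemma decay_poly:
  assumes "0 \<le> \<alpha>" "\<alpha> \<le> 1"
  shows "0 < decay_poly \<alpha> m" "decay \<alpha> (Suc m) = \<alpha> * decay_poly \<alpha> m / decay_poly \<alpha> (Suc m)"
proof -
  have "0 < decay_poly \<alpha> m \<and> 0 < decay_poly \<alpha> (Suc m) \<and>
    decay \<alpha> (Suc m) = \<alpha> * decay_poly \<alpha> m / decay_poly \<alpha> (Suc m)"
  proof (induction m)
    case (Suc m)
    let ?P = "decay_poly \<alpha> (Suc m)"
    have eq: "decay_poly \<alpha> (Suc (Suc m)) = ?P * (2 - \<alpha> * decay \<alpha> (Suc m))"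
      using Suc by (simp add: field_simps power2_eq_square del: decay.simps)
    then have pos: "0 < decay_poly \<alpha> (Suc (Suc m))"
      using Suc decay_denominator_pos[OF assms, of "Suc m"] by (metis mult_pos_pos)
    have "decay \<alpha> (Suc (Suc m)) = \<alpha> / (2 - \<alpha> * decay \<alpha> (Suc m))" by simp
    also have "\<dots> = \<alpha> * ?P / decay_poly \<alpha> (Suc (Suc m))"
      unfolding eq using Suc by (simp del: decay.simps)
    finally show ?case using Suc pos by blast
  qed simp
  then show "0 < decay_poly \<alpha> m" "decay \<alpha> (Suc m) = \<alpha> * decay_poly \<alpha> m / decay_poly \<alpha> (Suc m)"
    by auto
qed

text \<open>Writing \<open>n\<close> as \<open>m + 3\<close> makes the decay index
  \<open>n - 2\<close> a successor, for which the quotient formula applies.\<close>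

lemma gain_decay_poly:
  assumes "0 \<le> \<alpha>" "\<alpha> \<le> 1"
  defines "D \<equiv> \<lambda>m. (1 + \<alpha>) * decay_poly \<alpha> (Suc m) - \<alpha>^2 * decay_poly \<alpha> m"
  shows "0 < D m" "gain (m + 3) \<alpha> = 1 + (1 - \<alpha>) * decay_poly \<alpha> (Suc m) / (2 * D m)"
proof -
  let ?P = "decay_poly \<alpha> (Suc m)"
  have P: "0 < ?P" using decay_poly(1)[OF assms(1,2)] .
  have eq: "D m = ?P * (1 + \<alpha> * (1 - decay \<alpha> (Suc m)))"
    using P decay_poly(2)[OF assms(1,2), of m]
    by (simp add: D_def field_simps power2_eq_square del: decay.simps)
  moreover have "0 < 1 + \<alpha> * (1 - decay \<alpha> (Suc m))"
    using assms decay_bounds[of \<alpha> "Suc m"] by (simp add: add_pos_nonneg del: decay.simps)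
  ultimately show "0 < D m" using P by (metis mult_pos_pos)
  have "m + 3 - 2 = Suc m" by simp
  then show "gain (m + 3) \<alpha> = 1 + (1 - \<alpha>) * ?P / (2 * D m)"
    unfolding gain_def eq using P by (simp del: decay.simps)
qed

text \<open>The shape of the ratios for even \<open>n\<close>; the next lemma serves odd
  \<open>n\<close>. Each reduces an equality of fractions to two polynomial identities.\<close>

lemma half_plus_eq_gain:
  fixes A B D P \<alpha> :: real
  assumes "0 < D" "D + (1 - \<alpha>) * P = 2 * A" "B = D"
  shows "1 + (1 - \<alpha>) * P / (2 * D) = 1/2 + A / B"
  using assms by (simp add: field_simps)

lemma quotient_eq_gain:
  fixes A B D P \<alpha> :: real
  assumes "0 < D" "2 * D + (1 - \<alpha>) * P = 2 * A" "B = D"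
  shows "1 + (1 - \<alpha>) * P / (2 * D) = A / B"
  using assms by (simp add: field_simps)

lemma rho_eq_gain:
  assumes \<alpha>: "0 \<le> \<alpha>" "\<alpha> \<le> 1" and n: "4 \<le> n" "n \<le> 10"
  shows "rho n \<alpha> = gain n \<alpha>"
proof -
  note g = gain_decay_poly[OF \<alpha>]
  note simps = numeral_eq_Suc algebra_simps
  have "n \<in> {4,5,6,7,8,9,10}" using n by auto
  then consider "n = 4" | "n = 5" | "n = 6" | "n = 7" | "n = 8" | "n = 9" | "n = 10" by auto
  then show ?thesis
  proof cases
    case 1
    let ?A = "2*(\<alpha>^2 - 2)" and ?B = "(\<alpha> - 1)*\<alpha>*(4 + \<alpha>) - 4"
    \<comment> \<open>The stated denominator is the negative of the positive \<open>D\<close>, so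
      both parts of the fraction change sign; the same happens for 7 and 8.\<close>
    have "\<rho>\<^sub>4 \<alpha> = 1/2 + - ?A / - ?B"
      unfolding \<rho>\<^sub>4_def minus_divide_divide by (rule refl)
    also have "\<dots> = gain (1 + 3) \<alpha>"
      unfolding g(2) by (rule half_plus_eq_gain[symmetric, OF g(1)]) (simp_all add: simps)
    finally show ?thesis using 1 by (simp add: rho_def)
  next
    case 2
    have "\<rho>\<^sub>5 \<alpha> = gain (2 + 3) \<alpha>"
      unfolding g(2) \<rho>\<^sub>5_def by (rule quotient_eq_gain[symmetric, OF g(1)]) (simp_all add: simps)
    then show ?thesis using 2 by (simp add: rho_def)
  next
    case 3
    have "\<rho>\<^sub>6 \<alpha> = gain (3 + 3) \<alpha>"
      unfolding g(2) \<rho>\<^sub>6_def by (rule half_plus_eq_gain[symmetric, OF g(1)]) (simp_all add: simps)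
    then show ?thesis using 3 by (simp add: rho_def)
  next
    case 4
    let ?A = "\<alpha>*(\<alpha>*(64 + \<alpha>*(16 + \<alpha>*(\<alpha>*(\<alpha> - 3) - 21))) - 16) - 48"
    let ?B = "\<alpha>*(\<alpha>*(48 + \<alpha>*(32 + \<alpha>*((\<alpha> - 6)*\<alpha> - 18))) - 32) - 32"
    have "\<rho>\<^sub>7 \<alpha> = - ?A / - ?B"
      unfolding \<rho>\<^sub>7_def minus_divide_divide by (rule refl)
    also have "\<dots> = gain (4 + 3) \<alpha>"
      unfolding g(2) by (rule quotient_eq_gain[symmetric, OF g(1)]) (simp_all add: simps)
    finally show ?thesis using 4 by (simp add: rho_def)
  next
    case 5
    let ?A = "4*(\<alpha>^2 - 2)*(8 - 8*\<alpha>^2 + \<alpha>^4)"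
    let ?B = "\<alpha>*((\<alpha> - 2)*\<alpha>*(2 + \<alpha>)*(\<alpha>*(\<alpha>*(7 + \<alpha>) - 20) - 28) - 64) - 64"
    have "\<rho>\<^sub>8 \<alpha> = 1/2 + - ?A / - ?B"
      unfolding \<rho>\<^sub>8_def minus_divide_divide by (rule refl)
    also have "\<dots> = gain (5 + 3) \<alpha>"
      unfolding g(2) by (rule half_plus_eq_gain[symmetric, OF g(1)]) (simp_all add: simps)
    finally show ?thesis using 5 by (simp add: rho_def)
  next
    case 6
    have "\<rho>\<^sub>9 \<alpha> = gain (6 + 3) \<alpha>"
      unfolding g(2) \<rho>\<^sub>9_def by (rule quotient_eq_gain[symmetric, OF g(1)]) (simp_all add: simps)
    then show ?thesis using 6 by (simp add: rho_def)
  next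
    case 7
    have "\<rho>\<^sub>1\<^sub>0 \<alpha> = gain (7 + 3) \<alpha>"
      unfolding g(2) \<rho>\<^sub>1\<^sub>0_def by (rule half_plus_eq_gain[symmetric, OF g(1)]) (simp_all add: simps)
    then show ?thesis using 7 by (simp add: rho_def)
  qed
qed

subsection \<open>Client equilibria\<close>

lemma clients_measurable:
  assumes "client_mapping n f" "s \<in> location_vectors n" "i \<in> {1..n}"
  shows "clients_of s f i \<in> sets lborel"
proof -
  have "finite_interval_union (clients_of s f i)"
    using assms by (simp add: client_mapping_def)
  then obtain \<I> where "finite \<I>" "\<forall>I\<in>\<I>. is_interval I" "clients_of s f i = \<Union>\<I>"
    unfolding finite_interval_union_def by (elim exE conjE)
  then show ?thesis
    using sets.finite_Union[of \<I> lborel] real_interval_borel_measurable by (simp add: subset_iff)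
qed

lemma load_le:
  assumes "client_mapping n f" "s \<in> location_vectors n" "i \<in> {1..n}"
    and "clients_of s f i \<subseteq> {a..b}" "a \<le> b"
  shows "load s f i \<le> b - a"
proof -
  have "measure lborel (clients_of s f i) \<le> measure lborel {a..b}"
    using assms(4) clients_measurable[OF assms(1-3)]
    by (intro measure_mono_fmeasurable fmeasurableI) (auto simp: emeasure_lborel_Icc_eq)
  then show ?thesis using assms(5) by (simp add: load_def)
qed

lemma piece_containing:
  fixes \<beta> :: "nat \<Rightarrow> real"
  assumes "\<beta> 0 = 0" "\<beta> n = 1" "0 \<le> z" "z \<le> 1"
  obtains j where "j \<in> {1..n}" "\<beta> (j - 1) < \<beta> j" "\<beta> (j - 1) \<le> z" "z \<le> \<beta> j"
proof -
  \<comment> \<open>The conjunct \<open>0 < \<beta> j\<close> skips empty pieces at the left end, so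
    that the piece found for \<open>z = 0\<close> is also nondegenerate.\<close>
  define P where "P j \<longleftrightarrow> z \<le> \<beta> j \<and> 0 < \<beta> j" for j
  define j where "j = (LEAST j. P j)"
  have Pn: "P n" using assms by (simp add: P_def)
  have Pj: "P j" unfolding j_def by (rule LeastI[of P, OF Pn])
  have "j \<le> n" unfolding j_def by (rule Least_le[of P, OF Pn])
  moreover have "j \<noteq> 0" using Pj assms(1) by (cases j) (auto simp: P_def)
  moreover have "\<not> P (j - 1)" using not_less_Least[of "j - 1" P] \<open>j \<noteq> 0\<close> j_def by simp
  ultimately show ?thesis using Pj assms that[of j] by (auto simp: P_def)
qed

text \<open>One location vector together with the witnesses of its proper equilibrium; it is
  interpreted at \<open>s_opt\<close> and at its deviations.\<close>

locale proper_division =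
  fixes n :: nat and \<alpha> :: real and f :: "(nat \<Rightarrow> real) \<Rightarrow> real \<Rightarrow> nat"
    and t :: "nat \<Rightarrow> real" and \<pi> :: "nat \<Rightarrow> nat" and \<beta> :: "nat \<Rightarrow> real"
  assumes map: "client_mapping n f" and t: "t \<in> location_vectors n"
    and eq: "client_equilibrium n \<alpha> t f"
    and \<pi>: "\<pi> permutes {1..n}" and mono: "mono_on {1..n} (t \<circ> \<pi>)"
    and ends: "\<beta> 0 = 0" "\<beta> n = 1"
    and pieces: "i \<in> {1..n} \<Longrightarrow> \<beta> (i - 1) \<le> \<beta> i"
      "i \<in> {1..n} \<Longrightarrow> z \<in> {\<beta> (i - 1)<..<\<beta> i} \<Longrightarrow> f t z = \<pi> i"
begin

lemma \<beta>_range: "i \<le> n \<Longrightarrow> \<beta> i \<in> {0..1}"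
proof -
  assume "i \<le> n"
  have "0 \<le> \<beta> i"
    using \<open>i \<le> n\<close>
  proof (induction i)
    case (Suc i)
    then show ?case using pieces(1)[of "Suc i"] by simp
  qed (simp add: ends)
  moreover have "\<beta> i \<le> \<beta> n"
    using \<open>i \<le> n\<close>
  proof (induction i rule: inc_induct)
    case (step i)
    then show ?case using pieces(1)[of "Suc i"] by simp
  qed simp
  ultimately show ?thesis by (simp add: ends)
qed

lemma piece_subset: "i \<in> {1..n} \<Longrightarrow> {\<beta> (i - 1)<..<\<beta> i} \<subseteq> {0..1}"
  using \<beta>_range[of i] \<beta>_range[of "i - 1"] by fastforce

text \<open>Clients at boundaries may be assigned arbitrarily, but they form a finite set and hence
  a null set.\<close>

lemma load_eq:
  assumes i: "i \<in> {1..n}"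
  shows "load t f (\<pi> i) = \<beta> i - \<beta> (i - 1)"
proof -
  let ?C = "clients_of t f (\<pi> i)" and ?I = "{\<beta> (i - 1)<..<\<beta> i}" and ?N = "\<beta> ` {0..n}"
  have "?I \<subseteq> ?C"
    using pieces(2)[OF i] piece_subset[OF i] by (auto simp: clients_of_def)
  moreover have "?C \<subseteq> ?I \<union> ?N"
  proof
    fix z assume z: "z \<in> ?C"
    then obtain j where j: "j \<in> {1..n}" "\<beta> (j - 1) \<le> z" "z \<le> \<beta> j"
      using piece_containing[OF ends, of z] by (auto simp: clients_of_def)
    show "z \<in> ?I \<union> ?N"
    proof (cases "z \<in> ?N")
      case False
      then have "z \<noteq> \<beta> (j - 1)" "z \<noteq> \<beta> j" using j(1) by auto
      then have z': "z \<in> {\<beta> (j - 1)<..<\<beta> j}" using j by auto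
      then have "\<pi> j = \<pi> i" using pieces(2)[OF j(1)] z by (auto simp: clients_of_def)
      then have "j = i" using permutes_inj[OF \<pi>] by (auto dest: injD)
      then show ?thesis using z' by simp
    qed simp
  qed
  ultimately have "?C \<union> ?N = ?I \<union> ?N" by auto
  moreover have N: "?N \<in> null_sets lborel" by (intro finite_imp_null_set_lborel) simp
  moreover have "?C \<in> sets lborel"
    using clients_measurable[OF map t] permutes_in_image[OF \<pi>] i by blast
  ultimately have "measure lborel ?C = measure lborel ?I"
    using measure_Un_null_set[of ?C lborel ?N] measure_Un_null_set[of ?I lborel ?N] by simp
  then show ?thesis using pieces(1)[OF i] by (simp add: load_def)
qed

text \<open>Inside the piece this is the equilibrium condition. It extends by continuity to the end
  points, whose clients \<open>f\<close> may send elsewhere.\<close>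

lemma piece_cost_le:
  assumes i: "i \<in> {1..n}" and nonempty: "\<beta> (i - 1) < \<beta> i"
    and z: "z \<in> {\<beta> (i - 1)..\<beta> i}" and j: "j \<in> {1..n}"
  shows "(1 - \<alpha>) * \<bar>t (\<pi> i) - z\<bar> + \<alpha> * load t f (\<pi> i) \<le> (1 - \<alpha>) * \<bar>t j - z\<bar> + \<alpha> * load t f j"
proof -
  define d where "d z = ((1 - \<alpha>) * \<bar>t (\<pi> i) - z\<bar> + \<alpha> * load t f (\<pi> i))
      - ((1 - \<alpha>) * \<bar>t j - z\<bar> + \<alpha> * load t f j)" for z
  have cl: "closure {\<beta> (i - 1)<..<\<beta> i} = {\<beta> (i - 1)..\<beta> i}"
    using nonempty by (rule closure_greaterThanLessThan)
  have "d z \<le> 0"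
  proof (rule continuous_le_on_closure[of "{\<beta> (i - 1)<..<\<beta> i}" d])
    show "continuous_on (closure {\<beta> (i - 1)<..<\<beta> i}) d"
      unfolding d_def by (intro continuous_intros)
    show "z \<in> closure {\<beta> (i - 1)<..<\<beta> i}" using z cl by simp
    fix w assume w: "w \<in> {\<beta> (i - 1)<..<\<beta> i}"
    then have "w \<in> {0..1}" using piece_subset[OF i] by blast
    then have "client_cost \<alpha> t f w \<le> (1 - \<alpha>) * \<bar>t j - w\<bar> + \<alpha> * load t f j"
      using eq j by (simp add: client_equilibrium_def)
    then show "d w \<le> 0" using pieces(2)[OF i w] by (simp add: client_cost_def d_def)
  qed
  then show ?thesis by (simp add: d_def)
qed

text \<open>The client standing at a facility without load would pay nothing there, yet pays at
  least \<open>\<alpha>\<close> times a positive load where it is.\<close>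

lemma piece_nonempty:
  assumes \<alpha>: "0 < \<alpha>" "\<alpha> \<le> 1" and i: "i \<in> {1..n}"
  shows "\<beta> (i - 1) < \<beta> i"
proof (rule ccontr)
  assume "\<not> ?thesis"
  then have zero: "load t f (\<pi> i) = 0" using load_eq[OF i] pieces(1)[OF i] by simp
  have \<pi>i: "\<pi> i \<in> {1..n}" using permutes_in_image[OF \<pi>] i by blast
  then have "0 \<le> t (\<pi> i)" "t (\<pi> i) \<le> 1" using t by (auto simp: location_vectors_def PiE_iff)
  then obtain j where j: "j \<in> {1..n}" "\<beta> (j - 1) < \<beta> j" "t (\<pi> i) \<in> {\<beta> (j - 1)..\<beta> j}"
    using piece_containing[OF ends, of "t (\<pi> i)"] by auto
  have "(1 - \<alpha>) * \<bar>t (\<pi> j) - t (\<pi> i)\<bar> + \<alpha> * load t f (\<pi> j) \<le> 0"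
    using piece_cost_le[OF j \<pi>i] zero by simp
  moreover have "0 < \<alpha> * load t f (\<pi> j)" using load_eq[OF j(1)] j(2) \<alpha> by simp
  moreover have "0 \<le> (1 - \<alpha>) * \<bar>t (\<pi> j) - t (\<pi> i)\<bar>" using \<alpha> by simp
  ultimately show False by linarith
qed

lemma balanced:
  assumes \<alpha>: "0 < \<alpha>" "\<alpha> \<le> 1"
  shows "balanced n \<alpha> (t \<circ> \<pi>) \<beta>"
  unfolding balanced_def
proof (intro conjI allI impI)
  fix i assume "1 \<le> i \<and> i < n"
  then have i: "i \<in> {1..n}" "Suc i \<in> {1..n}" by auto
  then have \<pi>i: "\<pi> i \<in> {1..n}" "\<pi> (Suc i) \<in> {1..n}" using permutes_in_image[OF \<pi>] by blast+
  have "(1 - \<alpha>) * \<bar>t (\<pi> i) - \<beta> i\<bar> + \<alpha> * load t f (\<pi> i)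
      = (1 - \<alpha>) * \<bar>t (\<pi> (Suc i)) - \<beta> i\<bar> + \<alpha> * load t f (\<pi> (Suc i))"
    using piece_cost_le[OF i(1) piece_nonempty[OF \<alpha> i(1)] _ \<pi>i(2), of "\<beta> i"]
      piece_cost_le[OF i(2) piece_nonempty[OF \<alpha> i(2)] _ \<pi>i(1), of "\<beta> i"]
      pieces(1)[OF i(1)] pieces(1)[OF i(2)] by simp
  then show "(1 - \<alpha>) * (\<bar>(t \<circ> \<pi>) i - \<beta> i\<bar> - \<bar>(t \<circ> \<pi>) (Suc i) - \<beta> i\<bar>)
      = \<alpha> * ((\<beta> (Suc i) - \<beta> i) - (\<beta> i - \<beta> (i - 1)))"
    using load_eq[OF i(1)] load_eq[OF i(2)] by (simp add: algebra_simps)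
qed (use mono ends in auto)

lemma sum_load: "(\<Sum>i\<in>{1..n}. load t f i) = 1"
proof -
  have "(\<Sum>i\<in>{1..n}. load t f i) = (\<Sum>i\<in>{1..n}. load t f (\<pi> i))"
    using sum.permute[OF \<pi>, of "load t f"] by (simp add: comp_def)
  also have "\<dots> = (\<Sum>i\<in>{1..n}. \<beta> i - \<beta> (i - 1))" by (intro sum.cong refl load_eq)
  also have "\<dots> = \<beta> n - \<beta> 0" using sum_telescope''[of 0 n \<beta>] by simp
  finally show ?thesis by (simp add: ends)
qed

end

lemma proper_division_exists:
  assumes "induced_client_mapping n \<alpha> f" "t \<in> location_vectors n"
  obtains \<pi> \<beta> where "proper_division n \<alpha> f t \<pi> \<beta>"
proof -
  have "client_mapping n f" and "proper_client_equilibrium n \<alpha> t f"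
    using assms by (auto simp: induced_client_mapping_def)
  then obtain \<pi> \<beta> where "client_equilibrium n \<alpha> t f" "\<pi> permutes {1..n}"
    "mono_on {1..n} (t \<circ> \<pi>)" "\<beta> 0 = 0" "\<beta> n = 1"
    "\<forall>i\<in>{1..n}. \<beta> (i - 1) \<le> \<beta> i \<and> (\<forall>z\<in>{\<beta> (i - 1)<..<\<beta> i}. f t z = \<pi> i)"
    unfolding proper_client_equilibrium_def by metis
  then show ?thesis using \<open>client_mapping n f\<close> assms(2)
    by (intro that[of \<pi> \<beta>]) (simp add: proper_division_def)
qed

section \<open>Sorting permutations of the optimal and the deviated locations\<close>

lemma strict_mono_on_interval_id:
  fixes g :: "nat \<Rightarrow> nat"
  assumes g: "strict_mono_on {1..m} g" "g \<in> {1..m} \<rightarrow> {1..m}" and i: "i \<in> {1..m}"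
  shows "g i = i"
proof -
  have "j \<le> g j" if "1 \<le> j" "j \<le> m" for j
    using that
  proof (induction j rule: dec_induct)
    case base
    then show ?case using g(2) by fastforce
  next
    case (step j)
    then have "g j < g (Suc j)" by (intro strict_mono_onD[OF g(1)]) auto
    then show ?case using step by simp
  qed
  moreover have "g j \<le> j" if "j \<le> m" "1 \<le> j" for j
    using that
  proof (induction j rule: inc_induct)
    case base
    then show ?case using g(2) by fastforce
  next
    case (step j)
    then have "g j < g (Suc j)" by (intro strict_mono_onD[OF g(1)]) auto
    then show ?case using step by simp
  qed
  ultimately show ?thesis using i by (simp add: le_antisym)
qed

lemma sorting_id:
  assumes \<pi>: "\<pi> permutes {1..n}" and mono: "mono_on {1..n} (t \<circ> \<pi>)"
    and t: "\<And>j. j \<in> {1..n} \<Longrightarrow> t j = site n j" and i: "i \<in> {1..n}"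
  shows "\<pi> i = i"
proof (rule strict_mono_on_interval_id[OF _ _ i])
  show "\<pi> \<in> {1..n} \<rightarrow> {1..n}" using permutes_in_image[OF \<pi>] by blast
  show "strict_mono_on {1..n} \<pi>"
  proof (rule strict_mono_onI)
    fix a b assume ab: "a \<in> {1..n}" "b \<in> {1..n}" "a < b"
    then have \<pi>ab: "\<pi> a \<in> {1..n}" "\<pi> b \<in> {1..n}" using permutes_in_image[OF \<pi>] by blast+
    have "t (\<pi> a) \<le> t (\<pi> b)" using mono_onD[OF mono ab(1,2)] ab(3) by simp
    then have "\<pi> a \<le> \<pi> b"
      using t[OF \<pi>ab(1)] t[OF \<pi>ab(2)] ab by (simp add: site_def divide_le_cancel)
    moreover have "\<pi> a \<noteq> \<pi> b" using permutes_inj[OF \<pi>] ab(3) by (auto dest: injD)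
    ultimately show "\<pi> a < \<pi> b" by simp
  qed
qed

text \<open>The deviator may share a site with another facility, so its own position can be
  ambiguous. All other sites are distinct, which forces the order of the remaining
  facilities.\<close>

lemma sorting_skip:
  assumes \<pi>: "\<pi> permutes {1..n}" and mono: "mono_on {1..n} (t \<circ> \<pi>)"
    and p: "p \<in> {1..n}" and t: "\<And>j. j \<in> {1..n} \<Longrightarrow> j \<noteq> \<pi> p \<Longrightarrow> t j = site n j"
    and i: "i \<in> {1..<n}"
  shows "\<pi> (skip p i) = skip (\<pi> p) i"
proof -
  have inj: "\<pi> a = \<pi> b \<longleftrightarrow> a = b" for a b using permutes_inj[OF \<pi>] by (auto dest: injD)
  \<comment> \<open>Inverse of \<open>skip (\<pi> p)\<close> away from \<open>\<pi> p\<close>; thus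
    \<open>g\<close> is a strictly increasing self-map of \<open>{1..n - 1}\<close>, hence the
    identity.\<close>
  define unskip where "unskip j = (if j < \<pi> p then j else j - 1)" for j
  define g where "g j = unskip (\<pi> (skip p j))" for j
  have range: "skip p j \<in> {1..n}" "\<pi> (skip p j) \<in> {1..n}" "\<pi> (skip p j) \<noteq> \<pi> p"
    if "j \<in> {1..<n}" for j
  proof -
    show "skip p j \<in> {1..n}" using that by (auto simp: skip_def)
    then show "\<pi> (skip p j) \<in> {1..n}" using permutes_in_image[OF \<pi>] by blast
    have "skip p j \<noteq> p" by (simp add: skip_def)
    then show "\<pi> (skip p j) \<noteq> \<pi> p" by (simp add: inj)
  qed
  have \<pi>p: "\<pi> p \<in> {1..n}" using permutes_in_image[OF \<pi>] p by blast
  have "g i = i"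
  proof (rule strict_mono_on_interval_id[of "n - 1"])
    show "strict_mono_on {1..n - 1} g"
    proof (rule strict_mono_onI)
      fix a b assume ab: "a \<in> {1..n - 1}" "b \<in> {1..n - 1}" "a < b"
      then have ab': "a \<in> {1..<n}" "b \<in> {1..<n}" by auto
      note ra = range[OF ab'(1)] and rb = range[OF ab'(2)]
      have lt: "skip p a < skip p b" using ab(3) by (auto simp: skip_def)
      then have "t (\<pi> (skip p a)) \<le> t (\<pi> (skip p b))"
        using mono_onD[OF mono ra(1) rb(1)] by simp
      then have "\<pi> (skip p a) \<le> \<pi> (skip p b)"
        using t[OF ra(2,3)] t[OF rb(2,3)] p by (simp add: site_def divide_le_cancel)
      then have "\<pi> (skip p a) < \<pi> (skip p b)" using lt inj by (simp add: le_less)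
      then show "g a < g b" using ra(3) rb(3) by (auto simp: g_def unskip_def)
    qed
    show "g \<in> {1..n - 1} \<rightarrow> {1..n - 1}"
    proof
      fix a assume "a \<in> {1..n - 1}"
      then have "a \<in> {1..<n}" by auto
      then show "g a \<in> {1..n - 1}" using range[of a] \<pi>p by (auto simp: g_def unskip_def)
    qed
    show "i \<in> {1..n - 1}" using i by auto
  qed
  then show ?thesis
    using range[OF i] by (auto simp: g_def unskip_def skip_def split: if_splits)
qed

section \<open>Loads at the optimal locations and after a deviation, for positive congestion
  weight\<close>

lemma s_opt_site: "i \<in> {1..n} \<Longrightarrow> s_opt n i = site n i"
  by (simp add: s_opt_def site_def)

lemma s_opt_location: "s_opt n \<in> location_vectors n"
  by (auto simp: location_vectors_def s_opt_def field_simps)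

lemma deviation_location:
  assumes "k \<in> {1..n}" "x \<in> {0..1}"
  shows "(s_opt n)(k := x) \<in> location_vectors n"
  using s_opt_location[of n] assms unfolding location_vectors_def
  by (auto simp: PiE_iff extensional_def)

lemma load_s_opt_pos:
  assumes f: "induced_client_mapping n \<alpha> f" and \<alpha>: "0 < \<alpha>" "\<alpha> \<le> 1" and k: "k \<in> {1..n}"
  shows "load (s_opt n) f k = 1 / real n"
proof -
  obtain \<pi> \<beta> where "proper_division n \<alpha> f (s_opt n) \<pi> \<beta>"
    using proper_division_exists[OF f s_opt_location] .
  then interpret proper_division n \<alpha> f "s_opt n" \<pi> \<beta> .
  have \<pi>id: "\<pi> i = i" if "i \<in> {1..n}" for i
    using sorting_id[OF \<pi> mono s_opt_site that] .
  have \<beta>: "\<beta> i = real i / real n" if "i \<le> n" for i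
    using \<pi>id s_opt_site by (intro balanced_at_sites[OF balanced[OF \<alpha>] \<alpha> _ that]) simp
  have "load (s_opt n) f k = \<beta> k - \<beta> (k - 1)" using load_eq[OF k] \<pi>id[OF k] by simp
  also have "\<dots> = real k / real n - real (k - 1) / real n" using k by (subst (1 2) \<beta>) auto
  also have "\<dots> = 1 / real n" using k by (simp add: of_nat_diff diff_divide_distrib)
  finally show ?thesis .
qed

lemma load_deviation_pos:
  assumes f: "induced_client_mapping n \<alpha> f" and \<alpha>: "0 < \<alpha>" "\<alpha> \<le> 1"
    and k: "k \<in> {1..n}" and x: "x \<in> {0..1}"
  shows "load ((s_opt n)(k := x)) f k \<le> gain n \<alpha> / real n"
proof -
  let ?t = "(s_opt n)(k := x)"
  obtain \<pi> \<beta> where "proper_division n \<alpha> f ?t \<pi> \<beta>"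
    using proper_division_exists[OF f deviation_location[OF k x]] .
  then interpret proper_division n \<alpha> f ?t \<pi> \<beta> .
  obtain p where p: "p \<in> {1..n}" "\<pi> p = k"
    using k permutes_in_image[OF permutes_inv[OF \<pi>], of k] permutes_inverses(1)[OF \<pi>, of k]
    by blast
  have "\<beta> p - \<beta> (p - 1) \<le> gain n \<alpha> / real n"
  proof (rule piece_bound[OF balanced[OF \<alpha>] \<alpha> k p(1)])
    fix i assume i: "i \<in> {1..<n}"
    have "\<pi> (skip p i) = skip k i"
      using sorting_skip[OF \<pi> mono p(1) _ i] p(2) s_opt_site by simp
    moreover have "skip k i \<in> {1..n}" "skip k i \<noteq> k" using i by (auto simp: skip_def)
    ultimately show "(?t \<circ> \<pi>) (skip p i) = site n (skip k i)" by (simp add: s_opt_site)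
  qed
  then show ?thesis using load_eq[OF p(1)] p(2) by simp
qed

subsection \<open>The case without congestion\<close>

lemma client_nearest:
  assumes "induced_client_mapping n 0 f" "t \<in> location_vectors n"
    and "z \<in> clients_of t f i" "j \<in> {1..n}"
  shows "\<bar>t i - z\<bar> \<le> \<bar>t j - z\<bar>"
proof -
  have "client_equilibrium n 0 t f"
    using assms by (auto simp: induced_client_mapping_def proper_client_equilibrium_def)
  then show ?thesis
    using assms(3,4) by (auto simp: client_equilibrium_def client_cost_def clients_of_def)
qed

lemma nearer_halves:
  fixes a b z :: real
  assumes "a < b"
  shows "\<bar>b - z\<bar> \<le> \<bar>a - z\<bar> \<Longrightarrow> (a + b) / 2 \<le> z" "\<bar>a - z\<bar> \<le> \<bar>b - z\<bar> \<Longrightarrow> z \<le> (a + b) / 2"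
  using assms by (auto simp: abs_if split: if_splits)

text \<open>Nearest-facility choice confines each facility to its cell, so every load is at most
  \<open>1/n\<close>; since the loads add up to 1, all are equal to it.\<close>

lemma load_s_opt_zero:
  assumes f: "induced_client_mapping n 0 f" and k: "k \<in> {1..n}"
  shows "load (s_opt n) f k = 1 / real n"
proof -
  have map: "client_mapping n f" using f by (simp add: induced_client_mapping_def)
  have le: "load (s_opt n) f i \<le> 1 / real n" if i: "i \<in> {1..n}" for i
  proof -
    have n: "0 < n" using i by simp
    have "clients_of (s_opt n) f i \<subseteq> {real (i - 1) / real n..real i / real n}"
    proof
      fix z assume z: "z \<in> clients_of (s_opt n) f i"
      then have z01: "0 \<le> z" "z \<le> 1" by (auto simp: clients_of_def)
      have near: "\<bar>site n i - z\<bar> \<le> \<bar>site n j - z\<bar>" if "j \<in> {1..n}" for j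
        using client_nearest[OF f s_opt_location z that] s_opt_site[OF that] s_opt_site[OF i]
        by simp
      have "real (i - 1) / real n \<le> z"
      proof (cases "i = 1")
        case False
        then obtain m where m: "i = Suc m" "m \<in> {1..n}" using i by (cases i) auto
        then have "(site n m + site n i) / 2 \<le> z"
          using near[of m] site_Suc[OF n, of m] n by (intro nearer_halves(1)) auto
        then show ?thesis using site_mid[OF n, of m] m(1) by simp
      qed (use z01 in simp)
      moreover have "z \<le> real i / real n"
      proof (cases "i = n")
        case False
        then have "Suc i \<in> {1..n}" using i by auto
        then have "z \<le> (site n i + site n (Suc i)) / 2"
          using near[of "Suc i"] site_Suc[OF n, of i] n by (intro nearer_halves(2)) auto
        then show ?thesis using site_mid[OF n, of i] by simp
      qed (use z01 n in simp)
      ultimately show "z \<in> {real (i - 1) / real n..real i / real n}" by simp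
    qed
    then have "load (s_opt n) f i \<le> real i / real n - real (i - 1) / real n"
      by (rule load_le[OF map s_opt_location i]) (simp add: divide_right_mono)
    then show ?thesis using i by (simp add: of_nat_diff diff_divide_distrib)
  qed
  obtain \<pi> \<beta> where "proper_division n 0 f (s_opt n) \<pi> \<beta>"
    using proper_division_exists[OF f s_opt_location] .
  then interpret proper_division n 0 f "s_opt n" \<pi> \<beta> .
  have "1 = load (s_opt n) f k + (\<Sum>i\<in>{1..n} - {k}. load (s_opt n) f i)"
    using sum_load sum.remove[of "{1..n}" k "load (s_opt n) f"] k by simp
  also have "(\<Sum>i\<in>{1..n} - {k}. load (s_opt n) f i) \<le> real (card ({1..n} - {k})) * (1 / real n)"
    using le by (intro sum_bounded_above) auto
  also have "\<dots> = 1 - 1 / real n" using k by (simp add: of_nat_diff diff_divide_distrib)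
  finally show ?thesis using le[OF k] by simp
qed

text \<open>On a site held by another facility, the two share a window of length \<open>6h\<close>
  equally. Beyond all others, the deviator gets at most the \<open>3h\<close> up to the outermost
  remaining site. Strictly between two neighbours, it gets half their distance, at most
  \<open>2h\<close>.\<close>

lemma load_deviation_zero:
  assumes f: "induced_client_mapping n 0 f" and n: "4 \<le> n"
    and k: "k \<in> {1..n}" and x: "x \<in> {0..1}"
  shows "load ((s_opt n)(k := x)) f k \<le> 3 / (2 * real n)"
proof -
  let ?t = "(s_opt n)(k := x)"
  define h where "h = 1 / (2 * real n)"
  have h: "0 < h" "site n j = (2 * real j - 1) * h" "2 * real n * h = 1" for j
    using n by (simp_all add: h_def site_def)
  have site_less: "site n i < site n j" if "i < j" for i j
    using that h(1) by (simp add: h(2))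
  have site_gap: "site n j \<le> site n i + 4 * h" if "j \<le> i + 2" for i j
  proof -
    have "site n j \<le> site n (i + 2)"
      using that site_less[of j "i + 2"] by (cases "j = i + 2") auto
    then show ?thesis by (simp add: h(2) algebra_simps)
  qed
  have site_last: "1 - 3 * h \<le> site n j" if "n \<le> j + 1" for j
  proof -
    have "2 * real n * h \<le> (2 * real j + 2) * h" using that h(1) by (intro mult_right_mono) auto
    then show ?thesis using h(3) by (simp add: h(2) algebra_simps)
  qed
  have loc: "?t \<in> location_vectors n" using deviation_location[OF k x] .
  have map: "client_mapping n f" using f by (simp add: induced_client_mapping_def)
  have near: "\<bar>?t i - z\<bar> \<le> \<bar>site n j - z\<bar>"
    if "z \<in> clients_of ?t f i" "j \<in> {1..n}" "j \<noteq> k" for z i j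
    using client_nearest[OF f loc that(1,2)] that(2,3) by (simp add: s_opt_site)
  have range: "0 \<le> z" "z \<le> 1" if "z \<in> clients_of ?t f i" for z i
    using that by (auto simp: clients_of_def)
  have "load ?t f k \<le> 3 * h"
  proof (cases "\<exists>j\<in>{1..n}. j \<noteq> k \<and> x = site n j")
    case True
    then obtain j where j: "j \<in> {1..n}" "j \<noteq> k" "x = site n j" by blast
    then have tj: "?t j = x" "?t k = x" by (simp_all add: s_opt_site)
    \<comment> \<open>A facility other than \<open>k\<close> stands within \<open>4h\<close> on each
      side and cuts off at \<open>2h\<close>, unless \<open>x\<close> is near an end of the unit
      interval; there the interval itself ends within \<open>3h\<close>.\<close>
    have window: "clients_of ?t f i \<subseteq> {x - 3 * h..x + 3 * h}" if i: "?t i = x" for i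
    proof
      fix z assume z: "z \<in> clients_of ?t f i"
      have "x - 3 * h \<le> z"
      proof (cases "j \<le> 2")
        case True
        then have "x \<le> 3 * h" using j(3) h by simp
        then show ?thesis using range[OF z] by simp
      next
        case False
        then obtain l where l: "l \<in> {1..n}" "l \<noteq> k" "l < j" "j \<le> l + 2"
          using j(1) that[of "j - 1"] that[of "j - 2"] by (cases "j - 1 = k") auto
        have "site n l < site n j" "site n j - 4 * h \<le> site n l"
          using site_less[of l j] site_gap[of j l] l by auto
        then show ?thesis using near[OF z l(1,2)] i j(3) h(1) by (smt (verit))
      qed
      moreover have "z \<le> x + 3 * h"
      proof (cases "n \<le> j + 1")
        case True
        then have "1 \<le> x + 3 * h" using site_last j(3) by fastforce
        then show ?thesis using range[OF z] by simp
      next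
        case False
        then obtain l where l: "l \<in> {1..n}" "l \<noteq> k" "j < l" "l \<le> j + 2"
          using j(1) that[of "j + 1"] that[of "j + 2"] by (cases "j + 1 = k") auto
        have "site n j < site n l" "site n l \<le> site n j + 4 * h"
          using site_less[of j l] site_gap[of l j] l by auto
        then show ?thesis using near[OF z l(1,2)] i j(3) h(1) by (smt (verit))
      qed
      ultimately show "z \<in> {x - 3 * h..x + 3 * h}" by simp
    qed
    let ?K = "clients_of ?t f k" and ?J = "clients_of ?t f j"
    have meas: "?K \<in> sets lborel" "?J \<in> sets lborel"
      using clients_measurable[OF map loc] k j(1) by auto
    have W: "{x - 3 * h..x + 3 * h} \<in> fmeasurable lborel"
      by (intro fmeasurableI) (auto simp: emeasure_lborel_Icc_eq)
    have fm: "?K \<in> fmeasurable lborel" "?J \<in> fmeasurable lborel"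
      using fmeasurableI2[OF W window[OF tj(2)] meas(1)] fmeasurableI2[OF W window[OF tj(1)] meas(2)]
      by auto
    have "load ?t f k + load ?t f j = measure lborel (?K \<union> ?J)"
      unfolding load_def using fm j(2)
      by (subst measure_Un2) (auto simp: clients_of_def intro!: arg_cong[of _ _ "measure lborel"])
    also have "\<dots> \<le> measure lborel {x - 3 * h..x + 3 * h}"
      using window[OF tj(1)] window[OF tj(2)] meas
      by (intro measure_mono_fmeasurable W) auto
    also have "\<dots> = 6 * h" using h(1) by simp
    finally have "load ?t f k + load ?t f j \<le> 6 * h" .
    moreover have "load ?t f k = load ?t f j"
    proof -
      have "\<forall>i\<in>{1..n}. \<forall>j\<in>{1..n}. ?t i = ?t j \<longrightarrow> load ?t f i = load ?t f j"
        using f loc unfolding induced_client_mapping_def by blast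
      then show ?thesis using k j(1) tj by metis
    qed
    ultimately show ?thesis by simp
  next
    case False
    then have ne: "site n j < x \<or> x < site n j" if "j \<in> {1..n}" "j \<noteq> k" for j
      using that by (metis linorder_neqE)
    define A where "A = {j \<in> {1..n} - {k}. site n j < x}"
    define B where "B = {j \<in> {1..n} - {k}. x < site n j}"
    have AB: "finite A" "finite B" by (simp_all add: A_def B_def)
    have AB_Un: "A \<union> B = {1..n} - {k}" unfolding A_def B_def using ne by blast
    have below: "(site n l + x) / 2 \<le> z" if "l \<in> A" "z \<in> clients_of ?t f k" for l z
      using near[OF that(2), of l] that(1) by (auto simp: A_def abs_if split: if_splits)
    have above: "z \<le> (site n r + x) / 2" if "r \<in> B" "z \<in> clients_of ?t f k" for r z
      using near[OF that(2), of r] that(1) by (auto simp: B_def abs_if split: if_splits)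
    have bound: "load ?t f k \<le> b - a" if "a \<le> b" "\<And>z. z \<in> clients_of ?t f k \<Longrightarrow> a \<le> z \<and> z \<le> b"
      for a b
      using that by (intro load_le[OF map loc k]) auto
    consider "A = {}" | "B = {}" | "A \<noteq> {}" "B \<noteq> {}" by blast
    then show ?thesis
    proof cases
      case 1
      \<comment> \<open>The leftmost remaining facility, which is facility 2 when facility 1 is the
        deviator.\<close>
      define r where "r = (if k = 1 then 2 else 1 :: nat)"
      have r: "r \<in> B" "r \<le> 2" using 1 AB_Un n by (auto simp: r_def)
      then have "x < site n r" by (simp add: B_def)
      moreover have "site n r \<le> 3 * h" using r(2) h by simp
      ultimately have "load ?t f k \<le> 3 * h - 0"
        using above[OF r(1)] range h(1) by (intro bound) (auto, fastforce)
      then show ?thesis by simp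
    next
      case 2
      define l where "l = (if k = n then n - 1 else n)"
      have l: "l \<in> A" "n \<le> l + 1" using 2 AB_Un n k by (auto simp: l_def)
      then have "site n l < x" by (simp add: A_def)
      moreover have "1 - 3 * h \<le> site n l"
        using l(2) by (rule site_last)
      ultimately have "load ?t f k \<le> 1 - (1 - 3 * h)"
        using below[OF l(1)] range h(1) by (intro bound) (auto, fastforce)
      then show ?thesis by simp
    next
      case 3
      define l r where "l = Max A" and "r = Min B"
      have l: "l \<in> A" and r: "r \<in> B" using 3 AB by (auto simp: l_def r_def)
      have "site n l < site n r" using l r by (simp add: A_def B_def)
      then have "l < r" using h(1) by (simp add: h(2))
      have between: "j = k" if "l < j" "j < r" for j
      proof (rule ccontr)
        assume "j \<noteq> k"
        then have "j \<in> A \<union> B" using that l r AB_Un by (auto simp: A_def B_def)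
        then show False using that Max_ge[OF AB(1), of j] Min_le[OF AB(2), of j] by (auto simp: l_def r_def)
      qed
      \<comment> \<open>Only the vacated site \<open>k\<close> can lie between the two
        neighbours.\<close>
      have "r \<le> l + 2" using between[of "l + 1"] between[of "l + 2"] by (cases "l + 2 < r") auto
      then have "site n r \<le> site n l + 4 * h" by (rule site_gap)
      moreover have "load ?t f k \<le> (site n r + x) / 2 - (site n l + x) / 2"
        using above[OF r] below[OF l] \<open>site n l < site n r\<close> by (intro bound) auto
      ultimately show ?thesis using h(1) by argo
    qed
  qed
  then show ?thesis by (simp add: h_def)
qed

section \<open>The approximation ratio\<close>

theorem theorem3:
  fixes \<alpha> :: real and n :: nat and f :: "(nat \<Rightarrow> real) \<Rightarrow> real \<Rightarrow> nat"
  assumes "0 \<le> \<alpha>" and "\<alpha> \<le> 1"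
    and "4 \<le> n" and "n \<le> 10"
    and "induced_client_mapping n \<alpha> f"
  shows "SPE n \<alpha> (rho n \<alpha>) (s_opt n) f"
proof -
  have opt: "load (s_opt n) f i = 1 / real n"
    and dev: "load ((s_opt n)(i := x)) f i \<le> gain n \<alpha> / real n"
    if "i \<in> {1..n}" "x \<in> {0..1}" for i x
  proof -
    consider "\<alpha> = 0" | "0 < \<alpha>" using assms(1) by linarith
    then have "load (s_opt n) f i = 1 / real n \<and> load ((s_opt n)(i := x)) f i \<le> gain n \<alpha> / real n"
    proof cases
      case 1
      \<comment> \<open>The bound \<open>3/(2n)\<close> agrees with
        \<open>gain n 0 = 3/2\<close>.\<close>
      then show ?thesis
        using assms load_s_opt_zero load_deviation_zero that by (simp add: gain_def)
    next
      case 2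
      then show ?thesis
        using assms load_s_opt_pos load_deviation_pos that by blast
    qed
    then show "load (s_opt n) f i = 1 / real n"
      and "load ((s_opt n)(i := x)) f i \<le> gain n \<alpha> / real n" by auto
  qed
  have "client_mapping n f" "\<forall>t\<in>location_vectors n. client_equilibrium n \<alpha> t f"
    using assms(5) by (auto simp: induced_client_mapping_def proper_client_equilibrium_def)
  then show ?thesis
    using s_opt_location opt dev rho_eq_gain[OF assms(1-4)]
    by (simp add: SPE_def utility_def)
qed

end
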